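(* Let $\mathbf u=(u_1,u_2)^{\mathsf T}$ be a smooth solution on $\mathbb R^2$ of the coupled Fokas--Lenells system (see context), let $\lambda_0>0$, and let $\lambda(\eta)$ be the local holomorphic branch determined by $\lambda(\eta)^2=\lambda_0^2+\eta$, $\lambda(0)=\lambda_0$. Let $\mathcal Q\subseteq\mathbb C\setminus\mathbb R$ be a set of directions. Suppose that $\mathbf y(\eta)=\mathbf y(x,t;\eta)\in\mathbb C^3$ is a family of solutions of the Lax pair (with potential $\mathbf u$) at $\lambda=\lambda(\eta)$, defined for all sufficiently small nonzero $\eta$ along every direction under consideration, i.e. for $\eta=\varepsilon q$ with $q\in\mathcal Q$ and $\varepsilon\in\mathbb R\setminus\{0\}$ small, and that $$\mathbf y(\eta)=\mathbf y_R+\eta\,\mathbf y_\mu+O_{C^2_{\rm loc}}(|\eta|^2).$$ Assume that $\mathbf y_R$ is a nontrivial solution of the Lax pair at $\lambda=\lambda_0$ and that $\langle\mathbf y_R|J|\mathbf y_R\rangle=0$. For $q\in\mathcal Q$ define $$\mathfrak m_q=\frac{2\lambda_0}{q^*-q}\Big[q^*\langle\mathbf y_\mu|J|\mathbf y_R\rangle+q\langle\mathbf y_R|J|\mathbf y_\mu\rangle\Big]-\frac{\langle\mathbf y_R|K|\mathbf y_R\rangle}{2\lambda_0},$$ and, writing $\mathbf y_R=(\psi_R,\phi_R,\varphi_R)^{\mathsf T}$, $$\mathbf u^{(R;q)}=\mathbf u+\frac{2\psi_R^*}{\mathfrak m_q}\begin{pmatrix}\phi_R\\ \varphi_R\end{pmatrix}.$$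 Then for every $q\in\mathcal Q$ the Darboux denominator $$m(\eta)=\frac{\langle\mathbf y(\eta)|J|\mathbf y(\eta)\rangle}{\lambda(\eta)^*-\lambda(\eta)}-\frac{\langle\mathbf y(\eta)|K|\mathbf y(\eta)\rangle}{\lambda(\eta)^*+\lambda(\eta)}$$ satisfies $m(\varepsilon q)=\mathfrak m_q+O_{C^2_{\rm loc}}(\varepsilon)$ as $\varepsilon\to0$, $\varepsilon\in\mathbb R$. Moreover $$\operatorname{Re}\mathfrak m_q=-\frac{\|\mathbf y_R\|^2}{2\lambda_0}<0$$ at every real $(x,t)$. Consequently $\mathbf u^{(R;q)}$ is globally smooth on $\mathbb R^2$ and is an exact solution of the coupled Fokas--Lenells system.
   Context: Coupled Fokas--Lenells system for complex functions $u_1,u_2$ of $(x,t)\in\mathbb R^2$: $$u_{1,xt}+u_1+\mathrm i\big(|u_1|^2+\tfrac12|u_2|^2\big)u_{1,x}+\tfrac{\mathrm i}{2}u_1u_2^*u_{2,x}=0,\qquad u_{2,xt}+u_2+\mathrm i\big(|u_2|^2+\tfrac12|u_1|^2\big)u_{2,x}+\tfrac{\mathrm i}{2}u_2u_1^*u_{1,x}=0.$$ Lax pair with potential $\mathbf u=(u_1,u_2)^{\mathsf T}$ and spectral parameter $\lambda\ne0$: $\Phi_x=U(\lambda)\Phi$, $\Phi_t=V(\lambda)\Phi$, $\Phi\in\mathbb C^3$, with $P=\operatorname{diag}(1,0,0)$, $$U(\lambda)=\frac{2\mathrm i}{\lambda^2}P+\frac1\lambda\begin{pmatrix}0&\mathbf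 u_x^\dagger\\ \mathbf u_x&0_{2\times2}\end{pmatrix},\qquad V(\lambda)=\frac{\mathrm i\lambda^2}{2}P+\frac{\mathrm i\lambda}{2}\begin{pmatrix}0&-\mathbf u^\dagger\\ \mathbf u&0_{2\times2}\end{pmatrix}+\frac{\mathrm i}{2}\begin{pmatrix}\mathbf u^\dagger\mathbf u&0\\0&-\mathbf u\mathbf u^\dagger\end{pmatrix}.$$ A "Lax eigenfunction at $\lambda$" is a solution of both equations. $J=\operatorname{diag}(1,-1,-1)$, $K=I_3$, $\langle\mathbf f|J|\mathbf g\rangle=\mathbf f^\dagger J\mathbf g$, $\langle\mathbf f|K|\mathbf g\rangle=\mathbf f^\dagger\mathbf g$, $\|\mathbf f\|^2=\mathbf f^\dagger\mathbf f$; $^*$ is complex conjugation. $O_{C^2_{\rm loc}}(\cdot)$ means that on each compact subset of $\mathbb R^2$ the remainder and all its $x,t$-derivatives of total order at most two are bounded by a constant times the indicated quantity. *)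

theory Defs
  imports "HOL-Analysis.Analysis"
begin

text \<open>
  Functions of \<open>(x,t)\<close> are functions on \<^typ>\<open>real \<times> real\<close>, with \<open>x\<close> the first coordinate.
  The underlying \<^const>\<open>vector_derivative\<close> is unspecified where the partial derivative does not
  exist, so \<open>coupled_Fokas_Lenells\<close> below is meant to be used together with \<open>smooth\<close>.
\<close>

definition Dx :: "(real \<times> real \<Rightarrow> 'a::real_normed_vector) \<Rightarrow> real \<times> real \<Rightarrow> 'a" where
  "Dx f = (\<lambda>(x, t). vector_derivative (\<lambda>s. f (s, t)) (at x))"

definition Dt :: "(real \<times> real \<Rightarrow> 'a::real_normed_vector) \<Rightarrow> real \<times> real \<Rightarrow> 'a" where
  "Dt f = (\<lambda>(x, t). vector_derivative (\<lambda>s. f (x, s)) (at t))"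

primrec Ck :: "nat \<Rightarrow> (real \<times> real \<Rightarrow> 'a::real_normed_vector) \<Rightarrow> bool" where
  "Ck 0 f \<longleftrightarrow> continuous_on UNIV f"
| "Ck (Suc k) f \<longleftrightarrow> f differentiable_on UNIV \<and> Ck k (Dx f) \<and> Ck k (Dt f)"

definition smooth :: "(real \<times> real \<Rightarrow> 'a::real_normed_vector) \<Rightarrow> bool" where
  "smooth f \<longleftrightarrow> (\<forall>k. Ck k f)"

text \<open>
  \<open>O_C2loc g r\<close> says \<open>r(\<epsilon>) = O(g(\<epsilon>))\<close> in \<open>C\<^sup>2\<close> on compact sets, as the real parameter
  \<open>\<epsilon> \<noteq> 0\<close> tends to \<open>0\<close>. The constant and the range of \<open>\<epsilon>\<close> may depend on the compact set. Since
  \<open>r(\<epsilon>)\<close> is \<open>C\<^sup>2\<close>, the order of differentiation in the mixed derivative is immaterial.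
\<close>

definition O_C2loc ::
  "(real \<Rightarrow> real) \<Rightarrow> (real \<Rightarrow> real \<times> real \<Rightarrow> 'a::real_normed_vector) \<Rightarrow> bool" where
  "O_C2loc g r \<longleftrightarrow>
     (\<forall>\<^sub>F \<epsilon> in at 0. Ck 2 (r \<epsilon>)) \<and>
     (\<forall>S. compact S \<longrightarrow>
        (\<exists>C. \<forall>\<^sub>F \<epsilon> in at 0. \<forall>z\<in>S. \<forall>i j. i + j \<le> 2 \<longrightarrow>
           norm ((Dx ^^ i) ((Dt ^^ j) (r \<epsilon>)) z) \<le> C * g \<epsilon>))"

definition coupled_Fokas_Lenells :: "(real \<times> real \<Rightarrow> complex^2) \<Rightarrow> bool" where
  "coupled_Fokas_Lenells u \<longleftrightarrow> (\<forall>z.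
     Dt (Dx u) z $ 1 + u z $ 1
       + \<i> * ((cmod (u z $ 1))\<^sup>2 + 1/2 * (cmod (u z $ 2))\<^sup>2) * Dx u z $ 1
       + \<i>/2 * u z $ 1 * cnj (u z $ 2) * Dx u z $ 2 = 0 \<and>
     Dt (Dx u) z $ 2 + u z $ 2
       + \<i> * ((cmod (u z $ 2))\<^sup>2 + 1/2 * (cmod (u z $ 1))\<^sup>2) * Dx u z $ 2
       + \<i>/2 * u z $ 2 * cnj (u z $ 1) * Dx u z $ 1 = 0)"

definition Lax_U :: "(real \<times> real \<Rightarrow> complex^2) \<Rightarrow> complex \<Rightarrow> real \<times> real \<Rightarrow> complex^3^3" where
  "Lax_U u l z = (let v = Dx u z in vector
     [vector [2*\<i> / l\<^sup>2, cnj (v $ 1) / l, cnj (v $ 2) / l],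
      vector [v $ 1 / l,  0,              0],
      vector [v $ 2 / l,  0,              0]])"

definition Lax_V :: "(real \<times> real \<Rightarrow> complex^2) \<Rightarrow> complex \<Rightarrow> real \<times> real \<Rightarrow> complex^3^3" where
  "Lax_V u l z = (let a = u z $ 1; b = u z $ 2 in vector
     [vector [\<i> * l\<^sup>2 / 2 + \<i>/2 * (cnj a * a + cnj b * b), - \<i> * l / 2 * cnj a, - \<i> * l / 2 * cnj b],
      vector [\<i> * l / 2 * a, - \<i>/2 * (a * cnj a), - \<i>/2 * (a * cnj b)],
      vector [\<i> * l / 2 * b, - \<i>/2 * (b * cnj a), - \<i>/2 * (b * cnj b)]])"

definition Lax_eigenfunction ::
  "(real \<times> real \<Rightarrow> complex^2) \<Rightarrow> complex \<Rightarrow> (real \<times> real \<Rightarrow> complex^3) \<Rightarrow> bool" where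
  "Lax_eigenfunction u l \<Phi> \<longleftrightarrow> \<Phi> differentiable_on UNIV \<and>
     (\<forall>z. Dx \<Phi> z = Lax_U u l z *v \<Phi> z \<and> Dt \<Phi> z = Lax_V u l z *v \<Phi> z)"

definition J :: "complex^3^3" where
  "J = vector [vector [1, 0, 0], vector [0, -1, 0], vector [0, 0, -1]]"

definition K :: "complex^3^3" where
  "K = mat 1"

definition braket :: "complex^3 \<Rightarrow> complex^3^3 \<Rightarrow> complex^3 \<Rightarrow> complex"
    ("\<langle>_|_|_\<rangle>" [31, 31, 31] 1000) where
  "\<langle>f|M|g\<rangle> = (\<Sum>i\<in>UNIV. cnj (f $ i) * (M *v g) $ i)"

definition Darboux_denominator :: "complex \<Rightarrow> complex^3 \<Rightarrow> complex" where
  "Darboux_denominator l y = \<langle>y|J|y\<rangle> / (cnj l - l) - \<langle>y|K|y\<rangle> / (cnj l + l)"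

definition limit_denominator ::
  "real \<Rightarrow> complex \<Rightarrow> complex^3 \<Rightarrow> complex^3 \<Rightarrow> complex" where
  "limit_denominator lam0 q yR y\<mu> =
     2 * lam0 / (cnj q - q) * (cnj q * \<langle>y\<mu>|J|yR\<rangle> + q * \<langle>yR|J|y\<mu>\<rangle>) - \<langle>yR|K|yR\<rangle> / (2 * lam0)"

definition limit_potential ::
  "complex^2 \<Rightarrow> complex^3 \<Rightarrow> complex \<Rightarrow> complex^2" where
  "limit_potential u yR m = u + (2 * cnj (yR $ 1) / m) *s vector [yR $ 2, yR $ 3]"

end

theory Submission
  imports Defs
begin

text \<open>
  For a Lax eigenfunction \<open>(\<psi>, w)\<close> at a spectral parameter \<open>l\<close> with \<open>l\<^sup>2\<close> not real, the Darboux
  denominator satisfies the first-order equations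
  \<open>m\<^sub>x = 4 \<i> l \<bar>\<psi>\<bar>\<^sup>2 / \<bar>l\<bar>\<^sup>4 - 2 \<psi> w\<^sup>\<dagger> u\<^sub>x / \<bar>l\<bar>\<^sup>2\<close> and \<open>m\<^sub>t = - \<i> l \<bar>\<psi>\<bar>\<^sup>2 + \<i> \<psi>\<^sup>* u\<^sup>\<dagger> w\<close>, whose right-hand sides
  involve only the eigenfunction and have no singularity as \<open>l\<close> becomes real. Since \<open>m(\<epsilon>q)\<close> tends
  to \<open>\<mm>\<^sub>q\<close> in \<open>C\<^sup>2\<close> on compact sets, \<open>\<mm>\<^sub>q\<close> satisfies the same equations at \<open>lam0\<close>. In particular
  \<open>\<mm>\<^sub>q\<close> is smooth, and no equation for the coefficient \<open>y\<mu>\<close> is needed. The real part of \<open>\<mm>\<^sub>q\<close> does not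
  vanish because a solution of the Lax pair that vanishes at one point vanishes identically. With
  these two equations, \<open>\<bar>\<psi>\<bar>\<^sup>2 = \<bar>w\<bar>\<^sup>2\<close> and \<open>\<mm>\<^sub>q + \<mm>\<^sub>q\<^sup>* = - 2 \<bar>\<psi>\<bar>\<^sup>2 / lam0\<close>, the transformed potential solves the
  system by direct computation: its \<open>x\<close>-derivative factors as
  \<open>- (\<mm>\<^sub>q\<^sup>* / \<mm>\<^sub>q) (u\<^sub>x + (2 k / \<mm>\<^sub>q) w)\<close> with \<open>k = w\<^sup>\<dagger> u\<^sub>x / lam0 - 2 \<i> \<psi>\<^sup>* / lam0\<^sup>2\<close>.
\<close>

subsection \<open>Partial derivatives and the classes \<open>C\<^sup>k\<close>\<close>

text \<open>Chain rule along the two coordinate lines. It turns every rule for total derivatives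
  into a rule for \<open>Dx\<close> and \<open>Dt\<close> by evaluation at \<open>(1, 0)\<close> and
  \<open>(0, 1)\<close>.\<close>

lemma Dx_Dt_eqI:
  assumes "(f has_derivative f') (at z)"
  shows "Dx f z = f' (1, 0)" and "Dt f z = f' (0, 1)"
proof -
  obtain x t where z: "z = (x, t)" by (cases z)
  interpret f': bounded_linear f' using assms by (rule has_derivative_bounded_linear)
  have "((\<lambda>s. (s, t)) has_derivative (\<lambda>h. (h, 0))) (at x)"
    by (intro has_derivative_Pair has_derivative_ident has_derivative_const)
  from has_derivative_compose[OF this assms[unfolded z]]
  have "((\<lambda>s. f (s, t)) has_derivative (\<lambda>h. f' (h, 0))) (at x)" .
  moreover have "(\<lambda>h. f' (h, 0)) = (\<lambda>h. h *\<^sub>R f' (1, 0))"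
    by (simp add: fun_eq_iff flip: f'.scaleR)
  ultimately have "((\<lambda>s. f (s, t)) has_vector_derivative f' (1, 0)) (at x)"
    unfolding has_vector_derivative_def by (simp only:)
  then show "Dx f z = f' (1, 0)" by (simp add: Dx_def z vector_derivative_at)
  have "((\<lambda>s. (x, s)) has_derivative (\<lambda>h. (0, h))) (at t)"
    by (intro has_derivative_Pair has_derivative_ident has_derivative_const)
  from has_derivative_compose[OF this assms[unfolded z]]
  have "((\<lambda>s. f (x, s)) has_derivative (\<lambda>h. f' (0, h))) (at t)" .
  moreover have "(\<lambda>h. f' (0, h)) = (\<lambda>h. h *\<^sub>R f' (0, 1))"
    by (simp add: fun_eq_iff flip: f'.scaleR)
  ultimately have "((\<lambda>s. f (x, s)) has_vector_derivative f' (0, 1)) (at t)"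
    unfolding has_vector_derivative_def by (simp only:)
  then show "Dt f z = f' (0, 1)" by (simp add: Dt_def z vector_derivative_at)
qed

lemma has_vector_derivative_Dx_Dt:
  assumes "f differentiable (at (x, t))"
  shows "((\<lambda>s. f (s, t)) has_vector_derivative Dx f (x, t)) (at x)"
    and "((\<lambda>s. f (x, s)) has_vector_derivative Dt f (x, t)) (at t)"
proof -
  have "(\<lambda>s. f (s, t)) differentiable (at x)"
    by (rule differentiable_compose[of f "\<lambda>s. (s, t)"])
      (auto intro!: derivative_intros assms)
  then show "((\<lambda>s. f (s, t)) has_vector_derivative Dx f (x, t)) (at x)"
    by (simp add: Dx_def vector_derivative_works)
  have "(\<lambda>s. f (x, s)) differentiable (at t)"
    by (rule differentiable_compose[of f "\<lambda>s. (x, s)"])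
      (auto intro!: derivative_intros assms)
  then show "((\<lambda>s. f (x, s)) has_vector_derivative Dt f (x, t)) (at t)"
    by (simp add: Dt_def vector_derivative_works)
qed

lemma differentiable_on_UNIV_D: "f differentiable_on UNIV \<Longrightarrow> \<exists>f'. (f has_derivative f') (at z)"
  unfolding differentiable_on_def differentiable_def by simp

text \<open>Linearity rebuilds the total derivative from its values on the two basis vectors. In
  this form long products can be differentiated with \<open>derivative_eq_intros\<close> and the
  partial derivatives read off afterwards.\<close>

lemma has_derivative_Dx_Dt:
  assumes "f differentiable_on UNIV"
  shows "(f has_derivative (\<lambda>h. fst h *\<^sub>R Dx f z + snd h *\<^sub>R Dt f z)) (at z)"
proof -
  obtain f' where f': "(f has_derivative f') (at z)"
    using differentiable_on_UNIV_D[OF assms] by blast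
  interpret f': bounded_linear f' using f' by (rule has_derivative_bounded_linear)
  have "f' h = fst h *\<^sub>R f' (1, 0) + snd h *\<^sub>R f' (0, 1)" for h
    using f'.add[of "(fst h, 0)" "(0, snd h)"] f'.scaleR[of "fst h" "(1, 0)"] f'.scaleR[of "snd h" "(0, 1)"]
    by simp
  then have "f' = (\<lambda>h. fst h *\<^sub>R Dx f z + snd h *\<^sub>R Dt f z)"
    unfolding Dx_Dt_eqI[OF f'] by blast
  with f' show ?thesis by simp
qed

lemma Dx_Dt_const [simp]: "Dx (\<lambda>z. c) = (\<lambda>z. 0)" "Dt (\<lambda>z. c) = (\<lambda>z. 0)"
  by (auto simp: fun_eq_iff intro!: Dx_Dt_eqI(1)[where f' = "\<lambda>_. 0"] Dx_Dt_eqI(2)[where f' = "\<lambda>_. 0"])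

lemma Dx_Dt_add:
  assumes "f differentiable_on UNIV" "g differentiable_on UNIV"
  shows "Dx (\<lambda>z. f z + g z) = (\<lambda>z. Dx f z + Dx g z)"
    and "Dt (\<lambda>z. f z + g z) = (\<lambda>z. Dt f z + Dt g z)"
proof -
  have "Dx (\<lambda>z. f z + g z) z = Dx f z + Dx g z \<and> Dt (\<lambda>z. f z + g z) z = Dt f z + Dt g z" for z
  proof -
    from assms obtain f' g' where d: "(f has_derivative f') (at z)" "(g has_derivative g') (at z)"
      by (meson differentiable_on_UNIV_D)
    show ?thesis
      using Dx_Dt_eqI[OF d(1)] Dx_Dt_eqI[OF d(2)] Dx_Dt_eqI[OF has_derivative_add[OF d]] by simp
  qed
  then show "Dx (\<lambda>z. f z + g z) = (\<lambda>z. Dx f z + Dx g z)"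
    and "Dt (\<lambda>z. f z + g z) = (\<lambda>z. Dt f z + Dt g z)" by auto
qed

lemma Dx_Dt_linear:
  assumes "bounded_linear L" "f differentiable_on UNIV"
  shows "Dx (\<lambda>z. L (f z)) = (\<lambda>z. L (Dx f z))"
    and "Dt (\<lambda>z. L (f z)) = (\<lambda>z. L (Dt f z))"
proof -
  have "Dx (\<lambda>z. L (f z)) z = L (Dx f z) \<and> Dt (\<lambda>z. L (f z)) z = L (Dt f z)" for z
  proof -
    from assms obtain f' where d: "(f has_derivative f') (at z)"
      by (meson differentiable_on_UNIV_D)
    show ?thesis
      using Dx_Dt_eqI[OF d] Dx_Dt_eqI[OF bounded_linear.has_derivative[OF assms(1) d]] by simp
  qed
  then show "Dx (\<lambda>z. L (f z)) = (\<lambda>z. L (Dx f z))"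
    and "Dt (\<lambda>z. L (f z)) = (\<lambda>z. L (Dt f z))" by auto
qed

lemma Dx_Dt_bilinear:
  assumes "bounded_bilinear B" "f differentiable_on UNIV" "g differentiable_on UNIV"
  shows "Dx (\<lambda>z. B (f z) (g z)) = (\<lambda>z. B (f z) (Dx g z) + B (Dx f z) (g z))"
    and "Dt (\<lambda>z. B (f z) (g z)) = (\<lambda>z. B (f z) (Dt g z) + B (Dt f z) (g z))"
proof -
  have "Dx (\<lambda>z. B (f z) (g z)) z = B (f z) (Dx g z) + B (Dx f z) (g z) \<and>
        Dt (\<lambda>z. B (f z) (g z)) z = B (f z) (Dt g z) + B (Dt f z) (g z)" for z
  proof -
    from assms obtain f' g' where d: "(f has_derivative f') (at z)" "(g has_derivative g') (at z)"
      by (meson differentiable_on_UNIV_D)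
    show ?thesis
      using Dx_Dt_eqI[OF d(1)] Dx_Dt_eqI[OF d(2)] Dx_Dt_eqI[OF bounded_bilinear.FDERIV[OF assms(1) d]]
      by simp
  qed
  then show "Dx (\<lambda>z. B (f z) (g z)) = (\<lambda>z. B (f z) (Dx g z) + B (Dx f z) (g z))"
    and "Dt (\<lambda>z. B (f z) (g z)) = (\<lambda>z. B (f z) (Dt g z) + B (Dt f z) (g z))" by auto
qed

lemma Dx_Dt_inverse:
  fixes f :: "real \<times> real \<Rightarrow> complex"
  assumes "f differentiable_on UNIV" "\<And>z. f z \<noteq> 0"
  shows "Dx (\<lambda>z. inverse (f z)) = (\<lambda>z. - (inverse (f z) * inverse (f z)) * Dx f z)"
    and "Dt (\<lambda>z. inverse (f z)) = (\<lambda>z. - (inverse (f z) * inverse (f z)) * Dt f z)"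
proof -
  have "Dx (\<lambda>z. inverse (f z)) z = - (inverse (f z) * inverse (f z)) * Dx f z \<and>
        Dt (\<lambda>z. inverse (f z)) z = - (inverse (f z) * inverse (f z)) * Dt f z" for z
  proof -
    from assms obtain f' where d: "(f has_derivative f') (at z)"
      by (meson differentiable_on_UNIV_D)
    show ?thesis
      using Dx_Dt_eqI[OF d] Dx_Dt_eqI[OF Deriv.has_derivative_inverse[OF assms(2) d]] by simp
  qed
  then show "Dx (\<lambda>z. inverse (f z)) = (\<lambda>z. - (inverse (f z) * inverse (f z)) * Dx f z)"
    and "Dt (\<lambda>z. inverse (f z)) = (\<lambda>z. - (inverse (f z) * inverse (f z)) * Dt f z)" by auto
qed

section \<open>Closure of differentiability and of the classes C^k under algebraic
  operations\<close>

lemma bounded_linear_differentiable_on: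
  assumes "bounded_linear L" "f differentiable_on A"
  shows "(\<lambda>z. L (f z)) differentiable_on A"
  unfolding differentiable_on_def
proof
  fix x assume "x \<in> A"
  with assms(2) obtain f' where "(f has_derivative f') (at x within A)"
    unfolding differentiable_on_def differentiable_def by meson
  from bounded_linear.has_derivative[OF assms(1) this]
  show "(\<lambda>z. L (f z)) differentiable (at x within A)" by (rule differentiableI)
qed

lemma bounded_bilinear_differentiable_on:
  assumes "bounded_bilinear B" "f differentiable_on A" "g differentiable_on A"
  shows "(\<lambda>z. B (f z) (g z)) differentiable_on A"
  unfolding differentiable_on_def
proof
  fix x assume "x \<in> A"
  with assms(2,3) obtain f' g' where
    "(f has_derivative f') (at x within A)" "(g has_derivative g') (at x within A)"
    unfolding differentiable_on_def differentiable_def by meson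
  from bounded_bilinear.FDERIV[OF assms(1) this]
  show "(\<lambda>z. B (f z) (g z)) differentiable (at x within A)" by (rule differentiableI)
qed

text \<open>The recursive definition puts only differentiability at the top level, so the inclusion
  of the classes takes an induction through the derivatives. It is used wherever a product rule
  leaves a factor undifferentiated.\<close>

lemma Ck_SucD: "Ck (Suc k) f \<Longrightarrow> Ck k f"
proof (induction k arbitrary: f)
  case 0
  then show ?case by (simp add: differentiable_imp_continuous_on)
next
  case (Suc k)
  from Suc.prems have "f differentiable_on UNIV" "Ck (Suc k) (Dx f)" "Ck (Suc k) (Dt f)"
    unfolding Ck.simps(2)[of "Suc k"] by blast+
  with Suc.IH show ?case unfolding Ck.simps(2)[of k f] by blast
qed

lemma Ck_const: "Ck k (\<lambda>z. c)"
  by (induction k arbitrary: c) auto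

lemma Ck_add: "Ck k f \<Longrightarrow> Ck k g \<Longrightarrow> Ck k (\<lambda>z. f z + g z)"
proof (induction k arbitrary: f g)
  case (Suc k)
  then show ?case by (simp add: Dx_Dt_add differentiable_on_add)
qed (simp add: continuous_on_add)

lemma Ck_linear:
  assumes "bounded_linear L"
  shows "Ck k f \<Longrightarrow> Ck k (\<lambda>z. L (f z))"
proof (induction k arbitrary: f)
  case 0
  then show ?case by (simp add: bounded_linear.continuous_on[OF assms])
next
  case (Suc k)
  then show ?case
    by (simp add: Dx_Dt_linear[OF assms] bounded_linear_differentiable_on[OF assms])
qed

text \<open>One induction covers the complex product, scalar times vector, matrix times vector and
  the braket, all of which are bilinear over the reals.\<close>

lemma Ck_bilinear:
  assumes "bounded_bilinear B"
  shows "Ck k f \<Longrightarrow> Ck k g \<Longrightarrow> Ck k (\<lambda>z. B (f z) (g z))"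
proof (induction k arbitrary: f g)
  case 0
  then show ?case by (simp add: bounded_bilinear.continuous_on[OF assms])
next
  case (Suc k)
  with Ck_SucD[OF Suc.prems(1)] Ck_SucD[OF Suc.prems(2)] show ?case
    by (simp add: Dx_Dt_bilinear[OF assms] Ck_add bounded_bilinear_differentiable_on[OF assms])
qed

lemma Ck_minus: "Ck k f \<Longrightarrow> Ck k (\<lambda>z. - f z)"
  by (rule Ck_linear[OF bounded_linear_minus[OF bounded_linear_ident]])

lemma Ck_diff: "Ck k f \<Longrightarrow> Ck k g \<Longrightarrow> Ck k (\<lambda>z. f z - g z)"
  using Ck_add[of k f "\<lambda>z. - g z"] Ck_minus[of k g] by simp

lemma Ck_mult:
  fixes f g :: "real \<times> real \<Rightarrow> complex"
  shows "Ck k f \<Longrightarrow> Ck k g \<Longrightarrow> Ck k (\<lambda>z. f z * g z)"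
  by (rule Ck_bilinear[OF bounded_bilinear_mult])

lemma Ck_inverse:
  fixes f :: "real \<times> real \<Rightarrow> complex"
  assumes "\<And>z. f z \<noteq> 0"
  shows "Ck k f \<Longrightarrow> Ck k (\<lambda>z. inverse (f z))"
proof (induction k)
  case 0
  then show ?case using assms by (simp add: continuous_on_inverse)
next
  case (Suc k)
  have "Ck k (\<lambda>z. inverse (f z))" using Suc Ck_SucD by blast
  moreover have "(\<lambda>z. inverse (f z)) differentiable_on UNIV"
    using Suc.prems assms unfolding Ck.simps differentiable_on_def
    by (simp add: differentiable_inverse)
  ultimately show ?case using Suc.prems assms
    by (simp add: Dx_Dt_inverse Ck_mult Ck_minus)
qed

text \<open>A vector function is the finite sum of its components composed with the bounded linear
  maps \<open>axis i\<close>.\<close>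

lemma Ck_vec:
  fixes f :: "real \<times> real \<Rightarrow> 'a::real_normed_vector ^ 'n::finite"
  assumes "\<And>i. Ck k (\<lambda>z. f z $ i)"
  shows "Ck k f"
proof -
  have ax: "bounded_linear (axis i :: 'a \<Rightarrow> 'a^'n)" for i
    by (rule bounded_linear_intro[of _ 1]) (auto simp: axis_def vec_eq_iff norm_vec_def L2_set_def
      if_distrib[of norm] if_distrib[of "\<lambda>x. x^2"] cong: if_cong)
  have *: "Ck k (\<lambda>z. \<Sum>i\<in>I. axis i (f z $ i))" if "finite I" for I :: "'n set"
    using that by induction (auto intro!: Ck_const Ck_add Ck_linear[OF ax] assms)
  have "f = (\<lambda>z. \<Sum>i\<in>UNIV. axis i (f z $ i))"
    by (auto simp: fun_eq_iff vec_eq_iff axis_def if_distrib cong: if_cong)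
  with *[of UNIV] show ?thesis by simp
qed

lemma Ck_nth: "Ck k f \<Longrightarrow> Ck k (\<lambda>z. f z $ i)"
  by (rule Ck_linear[OF bounded_linear_vec_nth])

lemma Ck_cnj: "Ck k f \<Longrightarrow> Ck k (\<lambda>z. cnj (f z))"
  by (rule Ck_linear[OF bounded_linear_cnj])

lemma Ck_divide_const:
  fixes f :: "real \<times> real \<Rightarrow> complex"
  shows "Ck k f \<Longrightarrow> Ck k (\<lambda>z. f z / c)"
  unfolding divide_inverse by (intro Ck_mult Ck_const)

lemmas Ck_intros = Ck_const Ck_add Ck_diff Ck_minus Ck_mult Ck_nth Ck_cnj Ck_divide_const

lemma Dx_Dt_nth:
  assumes "f differentiable_on UNIV"
  shows "Dx (\<lambda>z. f z $ i) z = Dx f z $ i" "Dt (\<lambda>z. f z $ i) z = Dt f z $ i"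
  by (simp_all add: Dx_Dt_linear[OF bounded_linear_vec_nth assms])

lemma smooth_imp_differentiable_on: "smooth f \<Longrightarrow> f differentiable_on UNIV"
  unfolding smooth_def using Ck.simps(2) by blast

lemma smooth_Dx_Dt: "smooth f \<Longrightarrow> smooth (Dx f)" "smooth f \<Longrightarrow> smooth (Dt f)"
  unfolding smooth_def using Ck.simps(2) by blast+

subsection \<open>Calculus of \<open>O_C2loc\<close>\<close>

text \<open>The six terms are the derivatives \<open>(Dx ^^ i) ((Dt ^^ j) f)\<close> with
  \<open>i + j \<le> 2\<close>, which is why \<open>Dt (Dx f)\<close> does not occur. Their sum is
  subadditive and, up to a constant, submultiplicative on C^2 functions, so remainders can be
  multiplied.\<close>

definition C2norm :: "(real \<times> real \<Rightarrow> 'a::real_normed_vector) \<Rightarrow> real \<times> real \<Rightarrow> real" where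
  "C2norm f z = norm (f z) + norm (Dx f z) + norm (Dt f z)
     + norm (Dx (Dx f) z) + norm (Dx (Dt f) z) + norm (Dt (Dt f) z)"

lemma C2norm_nonneg: "0 \<le> C2norm f z"
  by (simp add: C2norm_def)

lemma derivs_le_2: "(\<forall>i j. i + j \<le> 2 \<longrightarrow> P ((Dx ^^ i) ((Dt ^^ j) f))) \<longleftrightarrow>
   P f \<and> P (Dx f) \<and> P (Dt f) \<and> P (Dx (Dx f)) \<and> P (Dx (Dt f)) \<and> P (Dt (Dt f))" (is "?l \<longleftrightarrow> ?r")
proof
  assume l: ?l
  show ?r using l[rule_format, of 0 0] l[rule_format, of 1 0] l[rule_format, of 0 1]
    l[rule_format, of 2 0] l[rule_format, of 1 1] l[rule_format, of 0 2]
    by (simp add: numeral_2_eq_2)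
next
  assume r: ?r
  show ?l
  proof (intro allI impI)
    fix i j :: nat assume "i + j \<le> 2"
    then consider "i = 0" "j = 0" | "i = 1" "j = 0" | "i = 0" "j = 1" | "i = 2" "j = 0"
      | "i = 1" "j = 1" | "i = 0" "j = 2" by linarith
    then show "P ((Dx ^^ i) ((Dt ^^ j) f))"
      by cases (use r in \<open>simp_all add: numeral_2_eq_2\<close>)
  qed
qed

text \<open>Each of the six nonnegative terms is at most their sum, and the sum is at most six times
  a common bound; only the constant changes.\<close>

lemma O_C2loc_iff:
  "O_C2loc g r \<longleftrightarrow> (\<forall>\<^sub>F \<epsilon> in at 0. Ck 2 (r \<epsilon>)) \<and>
     (\<forall>S. compact S \<longrightarrow> (\<exists>C. \<forall>\<^sub>F \<epsilon> in at 0. \<forall>z\<in>S. C2norm (r \<epsilon>) z \<le> C * g \<epsilon>))"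
proof -
  have 1: "(\<forall>i j. i + j \<le> 2 \<longrightarrow> norm ((Dx ^^ i) ((Dt ^^ j) f) z) \<le> M)" if "C2norm f z \<le> M"
    for f :: "real \<times> real \<Rightarrow> 'a" and z M
    using that unfolding derivs_le_2[where P = "\<lambda>f. norm (f z) \<le> M"] C2norm_def
    by (smt (verit) norm_ge_zero)
  have 2: "C2norm f z \<le> (6 * C) * h" if "(\<forall>i j. i + j \<le> 2 \<longrightarrow> norm ((Dx ^^ i) ((Dt ^^ j) f) z) \<le> C * h)"
    for f :: "real \<times> real \<Rightarrow> 'a" and z C h
    using that unfolding derivs_le_2[where P = "\<lambda>f. norm (f z) \<le> C * h"] C2norm_def
    by simp
  have "(\<exists>C. \<forall>\<^sub>F \<epsilon> in at 0. \<forall>z\<in>S. \<forall>i j. i + j \<le> 2 \<longrightarrow>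
           norm ((Dx ^^ i) ((Dt ^^ j) (r \<epsilon>)) z) \<le> C * g \<epsilon>) \<longleftrightarrow>
        (\<exists>C. \<forall>\<^sub>F \<epsilon> in at 0. \<forall>z\<in>S. C2norm (r \<epsilon>) z \<le> C * g \<epsilon>)" for S
  proof (intro iffI; elim exE)
    fix C assume "\<forall>\<^sub>F \<epsilon> in at 0. \<forall>z\<in>S. \<forall>i j. i + j \<le> 2 \<longrightarrow>
           norm ((Dx ^^ i) ((Dt ^^ j) (r \<epsilon>)) z) \<le> C * g \<epsilon>"
    then have "\<forall>\<^sub>F \<epsilon> in at 0. \<forall>z\<in>S. C2norm (r \<epsilon>) z \<le> (6 * C) * g \<epsilon>"
      by eventually_elim (intro ballI 2, blast)
    then show "\<exists>C. \<forall>\<^sub>F \<epsilon> in at 0. \<forall>z\<in>S. C2norm (r \<epsilon>) z \<le> C * g \<epsilon>" by blast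
  next
    fix C assume "\<forall>\<^sub>F \<epsilon> in at 0. \<forall>z\<in>S. C2norm (r \<epsilon>) z \<le> C * g \<epsilon>"
    then have "\<forall>\<^sub>F \<epsilon> in at 0. \<forall>z\<in>S. \<forall>i j. i + j \<le> 2 \<longrightarrow>
           norm ((Dx ^^ i) ((Dt ^^ j) (r \<epsilon>)) z) \<le> C * g \<epsilon>"
      by eventually_elim (intro ballI 1, blast)
    then show "\<exists>C. \<forall>\<^sub>F \<epsilon> in at 0. \<forall>z\<in>S. \<forall>i j. i + j \<le> 2 \<longrightarrow>
           norm ((Dx ^^ i) ((Dt ^^ j) (r \<epsilon>)) z) \<le> C * g \<epsilon>" by blast
  qed
  then show ?thesis unfolding O_C2loc_def by simp
qed

lemma Ck_2D:
  assumes "Ck 2 f"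
  shows "f differentiable_on UNIV" "Dx f differentiable_on UNIV" "Dt f differentiable_on UNIV"
    "continuous_on UNIV f" "continuous_on UNIV (Dx f)" "continuous_on UNIV (Dt f)"
    "continuous_on UNIV (Dx (Dx f))" "continuous_on UNIV (Dx (Dt f))" "continuous_on UNIV (Dt (Dt f))"
  using assms by (auto simp: numeral_2_eq_2 intro: differentiable_imp_continuous_on)

lemma C2norm_add:
  assumes "Ck 2 f" "Ck 2 g"
  shows "C2norm (\<lambda>z. f z + g z) z \<le> C2norm f z + C2norm g z"
proof -
  have "C2norm (\<lambda>z. f z + g z) z = norm (f z + g z) + norm (Dx f z + Dx g z) + norm (Dt f z + Dt g z)
     + norm (Dx (Dx f) z + Dx (Dx g) z) + norm (Dx (Dt f) z + Dx (Dt g) z) + norm (Dt (Dt f) z + Dt (Dt g) z)"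
    by (simp add: C2norm_def Dx_Dt_add Ck_2D assms)
  also have "\<dots> \<le> C2norm f z + C2norm g z"
    unfolding C2norm_def
    using norm_triangle_ineq[of "f z" "g z"] norm_triangle_ineq[of "Dx f z" "Dx g z"]
      norm_triangle_ineq[of "Dt f z" "Dt g z"] norm_triangle_ineq[of "Dx (Dx f) z" "Dx (Dx g) z"]
      norm_triangle_ineq[of "Dx (Dt f) z" "Dx (Dt g) z"] norm_triangle_ineq[of "Dt (Dt f) z" "Dt (Dt g) z"]
    by linarith
  finally show ?thesis .
qed

lemma C2norm_bilinear:
  assumes B: "bounded_bilinear B"
  obtains M where "M \<ge> 0"
    "\<And>f g z. Ck 2 f \<Longrightarrow> Ck 2 g \<Longrightarrow> C2norm (\<lambda>z. B (f z) (g z)) z \<le> M * (C2norm f z * C2norm g z)"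
proof -
  obtain L where L: "L \<ge> 0" "\<And>a b. norm (B a b) \<le> norm a * norm b * L"
    using bounded_bilinear.nonneg_bounded[OF B] by blast
  have "C2norm (\<lambda>z. B (f z) (g z)) z \<le> 17 * L * (C2norm f z * C2norm g z)"
    if f: "Ck 2 f" and g: "Ck 2 g" for f g z
  proof -
    define N where "N = L * (C2norm f z * C2norm g z)"
    have N: "norm (B a b) \<le> N" if "norm a \<le> C2norm f z" "norm b \<le> C2norm g z" for a b
    proof -
      have "norm (B a b) \<le> norm a * norm b * L" by (rule L)
      also have "\<dots> \<le> C2norm f z * C2norm g z * L"
        using that L(1) by (intro mult_mono) (auto simp: C2norm_nonneg)
      finally show ?thesis by (simp add: N_def mult.commute)
    qed
    have le: "norm (h z) \<le> C2norm h z" "norm (Dx h z) \<le> C2norm h z" "norm (Dt h z) \<le> C2norm h z"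
      "norm (Dx (Dx h) z) \<le> C2norm h z" "norm (Dx (Dt h) z) \<le> C2norm h z" "norm (Dt (Dt h) z) \<le> C2norm h z"
      for h :: "real \<times> real \<Rightarrow> 'd::real_normed_vector"
      by (simp_all add: C2norm_def)
    note eqs = Dx_Dt_bilinear[OF B] Dx_Dt_add bounded_bilinear_differentiable_on[OF B] Ck_2D[OF f] Ck_2D[OF g]
    \<comment> \<open>Each differentiation doubles the number of terms \<open>B _ _\<close>, and
      each such term is at most \<open>N\<close>. The total over the six derivatives is 1 + 2 + 2 +
      4 + 4 + 4 = 17.\<close>
    have 1: "norm (B (f z) (g z)) \<le> N"
      "norm (Dx (\<lambda>z. B (f z) (g z)) z) \<le> N + N" "norm (Dt (\<lambda>z. B (f z) (g z)) z) \<le> N + N"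
      "norm (Dx (Dx (\<lambda>z. B (f z) (g z))) z) \<le> (N + N) + (N + N)"
      "norm (Dx (Dt (\<lambda>z. B (f z) (g z))) z) \<le> (N + N) + (N + N)"
      "norm (Dt (Dt (\<lambda>z. B (f z) (g z))) z) \<le> (N + N) + (N + N)"
      by - (((simp only: eqs)?, intro norm_triangle_mono N le)+)
    have "C2norm (\<lambda>z. B (f z) (g z)) z \<le> 17 * N"
      unfolding C2norm_def[of "\<lambda>z. B (f z) (g z)"] using 1 by linarith
    then show ?thesis by (simp add: N_def)
  qed
  with that[of "17 * L"] L(1) show thesis by simp
qed

section \<open>Arithmetic of C^2 remainders\<close>

lemma O_C2loc_add:
  assumes r: "O_C2loc g r" and s: "O_C2loc g s"
  shows "O_C2loc g (\<lambda>\<epsilon> z. r \<epsilon> z + s \<epsilon> z)"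
  unfolding O_C2loc_iff
proof (intro conjI allI impI)
  have ck: "\<forall>\<^sub>F \<epsilon> in at 0. Ck 2 (r \<epsilon>)" "\<forall>\<^sub>F \<epsilon> in at 0. Ck 2 (s \<epsilon>)"
    using r s by (auto simp: O_C2loc_iff)
  then show "\<forall>\<^sub>F \<epsilon> in at 0. Ck 2 (\<lambda>z. r \<epsilon> z + s \<epsilon> z)"
    by eventually_elim (rule Ck_add)
  fix S :: "(real \<times> real) set" assume "compact S"
  then obtain C D where "\<forall>\<^sub>F \<epsilon> in at 0. \<forall>z\<in>S. C2norm (r \<epsilon>) z \<le> C * g \<epsilon>"
    "\<forall>\<^sub>F \<epsilon> in at 0. \<forall>z\<in>S. C2norm (s \<epsilon>) z \<le> D * g \<epsilon>"
    using r s by (auto simp: O_C2loc_iff) blast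
  with ck have "\<forall>\<^sub>F \<epsilon> in at 0. \<forall>z\<in>S. C2norm (\<lambda>z. r \<epsilon> z + s \<epsilon> z) z \<le> (C + D) * g \<epsilon>"
  proof eventually_elim
    case (elim \<epsilon>)
    show ?case
    proof
      fix z assume z: "z \<in> S"
      have "C2norm (\<lambda>z. r \<epsilon> z + s \<epsilon> z) z \<le> C2norm (r \<epsilon>) z + C2norm (s \<epsilon>) z"
        using elim by (intro C2norm_add) auto
      also have "\<dots> \<le> C * g \<epsilon> + D * g \<epsilon>"
        using elim z by (intro add_mono) auto
      finally show "C2norm (\<lambda>z. r \<epsilon> z + s \<epsilon> z) z \<le> (C + D) * g \<epsilon>" by (simp add: algebra_simps)
    qed
  qed
  then show "\<exists>C. \<forall>\<^sub>F \<epsilon> in at 0. \<forall>z\<in>S. C2norm (\<lambda>z. r \<epsilon> z + s \<epsilon> z) z \<le> C * g \<epsilon>" by blast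
qed

text \<open>Rates multiply under any bounded bilinear map. Together with
  \<open>O_C2loc_const\<close> and \<open>O_C2loc_scalar\<close> this yields all later estimates of
  brakets and of scalar multiples.\<close>

lemma O_C2loc_bilinear:
  assumes B: "bounded_bilinear B" and r: "O_C2loc g r" and s: "O_C2loc h s"
  shows "O_C2loc (\<lambda>\<epsilon>. g \<epsilon> * h \<epsilon>) (\<lambda>\<epsilon> z. B (r \<epsilon> z) (s \<epsilon> z))"
  unfolding O_C2loc_iff
proof (intro conjI allI impI)
  have ck: "\<forall>\<^sub>F \<epsilon> in at 0. Ck 2 (r \<epsilon>)" "\<forall>\<^sub>F \<epsilon> in at 0. Ck 2 (s \<epsilon>)"
    using r s by (auto simp: O_C2loc_iff)
  then show "\<forall>\<^sub>F \<epsilon> in at 0. Ck 2 (\<lambda>z. B (r \<epsilon> z) (s \<epsilon> z))"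
    by eventually_elim (rule Ck_bilinear[OF B])
  obtain M where M: "M \<ge> 0"
    "\<And>f g z. Ck 2 f \<Longrightarrow> Ck 2 g \<Longrightarrow> C2norm (\<lambda>z. B (f z) (g z)) z \<le> M * (C2norm f z * C2norm g z)"
    using C2norm_bilinear[OF B] by blast
  fix S :: "(real \<times> real) set" assume "compact S"
  then obtain C D where "\<forall>\<^sub>F \<epsilon> in at 0. \<forall>z\<in>S. C2norm (r \<epsilon>) z \<le> C * g \<epsilon>"
    "\<forall>\<^sub>F \<epsilon> in at 0. \<forall>z\<in>S. C2norm (s \<epsilon>) z \<le> D * h \<epsilon>"
    using r s by (auto simp: O_C2loc_iff) blast
  with ck have "\<forall>\<^sub>F \<epsilon> in at 0. \<forall>z\<in>S. C2norm (\<lambda>z. B (r \<epsilon> z) (s \<epsilon> z)) z \<le> (M * C * D) * (g \<epsilon> * h \<epsilon>)"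
  proof eventually_elim
    case (elim \<epsilon>)
    show ?case
    proof
      fix z assume z: "z \<in> S"
      have "C2norm (\<lambda>z. B (r \<epsilon> z) (s \<epsilon> z)) z \<le> M * (C2norm (r \<epsilon>) z * C2norm (s \<epsilon>) z)"
        using elim by (intro M) auto
      also have "\<dots> \<le> M * ((C * g \<epsilon>) * (D * h \<epsilon>))"
        \<comment> \<open>Monotonicity of the product needs \<open>0 \<le> C * g \<epsilon>\<close>;
          this follows because the quantity dominates a \<open>C2norm\<close>.\<close>
        using elim z M(1) order_trans[OF C2norm_nonneg[of "r \<epsilon>" z], of "C * g \<epsilon>"]
        by (intro mult_left_mono mult_mono) (auto simp: C2norm_nonneg)
      finally show "C2norm (\<lambda>z. B (r \<epsilon> z) (s \<epsilon> z)) z \<le> (M * C * D) * (g \<epsilon> * h \<epsilon>)"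
        by (simp add: algebra_simps)
    qed
  qed
  then show "\<exists>C. \<forall>\<^sub>F \<epsilon> in at 0. \<forall>z\<in>S. C2norm (\<lambda>z. B (r \<epsilon> z) (s \<epsilon> z)) z \<le> C * (g \<epsilon> * h \<epsilon>)" by blast
qed

text \<open>A fixed C^2 function has a continuous \<open>C2norm\<close>, which is bounded on compact
  sets.\<close>

lemma O_C2loc_const:
  assumes "Ck 2 f"
  shows "O_C2loc (\<lambda>_. 1) (\<lambda>_. f)"
  unfolding O_C2loc_iff
proof (intro conjI allI impI)
  fix S :: "(real \<times> real) set" assume "compact S"
  moreover have "continuous_on S (C2norm f)"
    unfolding C2norm_def
    by (intro continuous_intros; rule continuous_on_subset[of UNIV]; simp add: Ck_2D assms)
  ultimately have "bounded (C2norm f ` S)"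
    by (intro compact_imp_bounded compact_continuous_image)
  then obtain C where "\<forall>z\<in>S. C2norm f z \<le> C"
    by (auto simp: bounded_real abs_le_iff)
  then show "\<exists>C. \<forall>\<^sub>F \<epsilon> in at (0::real). \<forall>z\<in>S. C2norm f z \<le> C * 1" by auto
qed (use assms in simp)

lemma O_C2loc_scalar:
  assumes "\<forall>\<^sub>F \<epsilon> in at 0. norm (a \<epsilon>) \<le> C * g \<epsilon>"
  shows "O_C2loc g (\<lambda>\<epsilon> z. a \<epsilon>)"
  unfolding O_C2loc_iff using assms by (auto simp: Ck_const C2norm_def)

lemma O_C2loc_weaken:
  assumes r: "O_C2loc g r" and g: "\<forall>\<^sub>F \<epsilon> in at 0. 0 \<le> g \<epsilon> \<and> g \<epsilon> \<le> M * h \<epsilon>"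
  shows "O_C2loc h r"
  unfolding O_C2loc_iff
proof (intro conjI allI impI)
  show "\<forall>\<^sub>F \<epsilon> in at 0. Ck 2 (r \<epsilon>)" using r by (auto simp: O_C2loc_iff)
  fix S :: "(real \<times> real) set" assume "compact S"
  then obtain C where "\<forall>\<^sub>F \<epsilon> in at 0. \<forall>z\<in>S. C2norm (r \<epsilon>) z \<le> C * g \<epsilon>"
    using r by (auto simp: O_C2loc_iff)
  \<comment> \<open>The absolute value is taken because the constant \<open>C\<close> may be
    negative.\<close>
  with g have "\<forall>\<^sub>F \<epsilon> in at 0. \<forall>z\<in>S. C2norm (r \<epsilon>) z \<le> (\<bar>C\<bar> * M) * h \<epsilon>"
  proof eventually_elim
    case (elim \<epsilon>)
    have "C * g \<epsilon> \<le> \<bar>C\<bar> * (M * h \<epsilon>)" using elim by (intro mult_mono) auto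
    with elim show ?case by (auto simp: mult.assoc intro: order_trans)
  qed
  then show "\<exists>C. \<forall>\<^sub>F \<epsilon> in at 0. \<forall>z\<in>S. C2norm (r \<epsilon>) z \<le> C * h \<epsilon>" by blast
qed

lemma O_C2loc_cong:
  assumes "O_C2loc g r" "\<forall>\<^sub>F \<epsilon> in at 0. s \<epsilon> = r \<epsilon>"
  shows "O_C2loc g s"
  unfolding O_C2loc_iff
proof (intro conjI allI impI)
  have "\<forall>\<^sub>F \<epsilon> in at 0. Ck 2 (r \<epsilon>)" using assms(1) by (simp add: O_C2loc_iff)
  with assms(2) show "\<forall>\<^sub>F \<epsilon> in at 0. Ck 2 (s \<epsilon>)" by eventually_elim simp
  fix S :: "(real \<times> real) set" assume "compact S"
  then obtain C where "\<forall>\<^sub>F \<epsilon> in at 0. \<forall>z\<in>S. C2norm (r \<epsilon>) z \<le> C * g \<epsilon>"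
    using assms(1) unfolding O_C2loc_iff by blast
  with assms(2) have "\<forall>\<^sub>F \<epsilon> in at 0. \<forall>z\<in>S. C2norm (s \<epsilon>) z \<le> C * g \<epsilon>" by eventually_elim simp
  then show "\<exists>C. \<forall>\<^sub>F \<epsilon> in at 0. \<forall>z\<in>S. C2norm (s \<epsilon>) z \<le> C * g \<epsilon>" by blast
qed

lemma O_C2loc_square:
  assumes "O_C2loc (\<lambda>\<epsilon>. \<epsilon>\<^sup>2) f"
  shows "O_C2loc abs f"
proof (rule O_C2loc_weaken[OF assms])
  have "\<forall>\<^sub>F \<epsilon> in at (0::real). \<bar>\<epsilon>\<bar> \<le> 1"
    by (auto simp: eventually_at dist_real_def intro: exI[of _ 1])
  then show "\<forall>\<^sub>F \<epsilon> in at (0::real). 0 \<le> \<epsilon>\<^sup>2 \<and> \<epsilon>\<^sup>2 \<le> 1 * \<bar>\<epsilon>\<bar>"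
  proof eventually_elim
    case (elim \<epsilon>)
    have "\<bar>\<epsilon>\<bar> * \<bar>\<epsilon>\<bar> \<le> 1 * \<bar>\<epsilon>\<bar>" using elim by (intro mult_right_mono) auto
    then show ?case by (simp add: power2_eq_square)
  qed
qed

lemma O_C2loc_minus:
  assumes "O_C2loc g r"
  shows "O_C2loc g (\<lambda>\<epsilon> z. - r \<epsilon> z)"
  using O_C2loc_bilinear[OF bounded_bilinear_scaleR O_C2loc_const[OF Ck_const[of 2 "-1"]] assms]
  by simp

text \<open>A singleton is compact, so the local bound gives convergence of values and first
  derivatives at each point.\<close>

lemma O_C2loc_tendsto:
  assumes "O_C2loc abs r"
  shows "((\<lambda>\<epsilon>. r \<epsilon> z) \<longlongrightarrow> 0) (at 0)"
    and "((\<lambda>\<epsilon>. Dx (r \<epsilon>) z) \<longlongrightarrow> 0) (at 0)"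
    and "((\<lambda>\<epsilon>. Dt (r \<epsilon>) z) \<longlongrightarrow> 0) (at 0)"
proof -
  have "compact {z}" by simp
  with assms obtain C where C: "\<forall>\<^sub>F \<epsilon> in at 0. \<forall>z\<in>{z}. C2norm (r \<epsilon>) z \<le> C * \<bar>\<epsilon>\<bar>"
    unfolding O_C2loc_iff by blast
  have lim: "((\<lambda>\<epsilon>::real. C * \<bar>\<epsilon>\<bar>) \<longlongrightarrow> 0) (at 0)"
    by (auto intro!: tendsto_eq_intros)
  have lims: "((\<lambda>\<epsilon>. h \<epsilon>) \<longlongrightarrow> 0) (at 0)" if "\<And>\<epsilon>. norm (h \<epsilon>) \<le> C2norm (r \<epsilon>) z" for h :: "real \<Rightarrow> 'a"
  proof (rule Lim_null_comparison[OF _ lim])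
    show "\<forall>\<^sub>F \<epsilon> in at 0. norm (h \<epsilon>) \<le> C * \<bar>\<epsilon>\<bar>"
      using C by eventually_elim (use that in \<open>auto intro: order_trans\<close>)
  qed
  show "((\<lambda>\<epsilon>. r \<epsilon> z) \<longlongrightarrow> 0) (at 0)" "((\<lambda>\<epsilon>. Dx (r \<epsilon>) z) \<longlongrightarrow> 0) (at 0)"
    "((\<lambda>\<epsilon>. Dt (r \<epsilon>) z) \<longlongrightarrow> 0) (at 0)"
    by (rule lims, simp add: C2norm_def)+
qed

subsection \<open>Lax eigenfunctions\<close>

lemma braket_J: "\<langle>f|J|g\<rangle> = cnj (f $ 1) * g $ 1 - cnj (f $ 2) * g $ 2 - cnj (f $ 3) * g $ 3"
  by (simp add: braket_def J_def matrix_vector_mult_def sum_3)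

lemma braket_K: "\<langle>f|K|g\<rangle> = cnj (f $ 1) * g $ 1 + cnj (f $ 2) * g $ 2 + cnj (f $ 3) * g $ 3"
  by (simp add: braket_def K_def sum_3)

text \<open>The braket is conjugate-linear in its first argument, hence bilinear over the reals; in
  finite dimension this already gives boundedness.\<close>

lemma bounded_bilinear_braket: "bounded_bilinear (\<lambda>f g. \<langle>f|M|g\<rangle>)"
  unfolding bilinear_conv_bounded_bilinear[symmetric] bilinear_def braket_def
  by (auto intro!: linearI simp: algebra_simps matrix_vector_mult_def sum_3 scaleR_conv_of_real[where 'a = complex])

lemma bounded_bilinear_matrix_vector_mult_complex:
  "bounded_bilinear ((*v) :: complex^3^3 \<Rightarrow> complex^3 \<Rightarrow> complex^3)"
  unfolding bilinear_conv_bounded_bilinear[symmetric] bilinear_def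
  by (auto intro!: linearI simp: algebra_simps matrix_vector_mult_def sum_3 vec_eq_iff scaleR_conv_of_real[where 'a = complex])

lemma Lax_eigenfunction_derivs:
  assumes "Lax_eigenfunction u l \<Phi>"
  shows "Dx \<Phi> z $ 1 = 2 * \<i> / l\<^sup>2 * \<Phi> z $ 1 + (cnj (Dx u z $ 1) * \<Phi> z $ 2 + cnj (Dx u z $ 2) * \<Phi> z $ 3) / l" (is ?D1)
    and "Dx \<Phi> z $ 2 = Dx u z $ 1 * \<Phi> z $ 1 / l" (is ?D2)
    and "Dx \<Phi> z $ 3 = Dx u z $ 2 * \<Phi> z $ 1 / l" (is ?D3)
    and "Dt \<Phi> z $ 1 = (\<i> * l\<^sup>2 / 2 + \<i>/2 * (cnj (u z $ 1) * u z $ 1 + cnj (u z $ 2) * u z $ 2)) * \<Phi> z $ 1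
      - \<i> * l / 2 * (cnj (u z $ 1) * \<Phi> z $ 2 + cnj (u z $ 2) * \<Phi> z $ 3)" (is ?D4)
    and "Dt \<Phi> z $ 2 = \<i> * l / 2 * u z $ 1 * \<Phi> z $ 1
      - \<i>/2 * u z $ 1 * (cnj (u z $ 1) * \<Phi> z $ 2 + cnj (u z $ 2) * \<Phi> z $ 3)" (is ?D5)
    and "Dt \<Phi> z $ 3 = \<i> * l / 2 * u z $ 2 * \<Phi> z $ 1
      - \<i>/2 * u z $ 2 * (cnj (u z $ 1) * \<Phi> z $ 2 + cnj (u z $ 2) * \<Phi> z $ 3)" (is ?D6)
proof -
  have "Dx \<Phi> z = Lax_U u l z *v \<Phi> z" "Dt \<Phi> z = Lax_V u l z *v \<Phi> z"
    using assms unfolding Lax_eigenfunction_def by blast+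
  then show ?D1 ?D2 ?D3 ?D4 ?D5 ?D6
    by (simp_all add: Lax_U_def Lax_V_def Let_def matrix_vector_mult_def sum_3
        add_divide_distrib algebra_simps)
qed

lemma Ck_Lax:
  assumes "smooth u"
  shows "Ck k (Lax_U u l)" "Ck k (Lax_V u l)"
proof -
  have u: "Ck k u" "Ck k (Dx u)"
    using assms smooth_Dx_Dt[of u] by (auto simp: smooth_def)
  have "Ck k (\<lambda>z. Lax_U u l z $ i $ j)" "Ck k (\<lambda>z. Lax_V u l z $ i $ j)" for i j
    using exhaust_3[of i] exhaust_3[of j]
    by (elim disjE; simp add: Lax_U_def Lax_V_def Let_def; intro Ck_intros u)+
  then show "Ck k (Lax_U u l)" "Ck k (Lax_V u l)" by (auto intro!: Ck_vec)
qed

text \<open>Bootstrapping: both derivatives are a smooth matrix times the eigenfunction, so class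
  C^k implies class C^(k+1).\<close>

lemma Lax_eigenfunction_smooth:
  assumes "smooth u" "Lax_eigenfunction u l \<Phi>"
  shows "smooth \<Phi>"
proof -
  have eq: "Dx \<Phi> = (\<lambda>z. Lax_U u l z *v \<Phi> z)" "Dt \<Phi> = (\<lambda>z. Lax_V u l z *v \<Phi> z)"
    and d: "\<Phi> differentiable_on UNIV"
    using assms(2) by (auto simp: Lax_eigenfunction_def)
  have "Ck k \<Phi>" for k
  proof (induction k)
    case 0
    then show ?case using d by (simp add: differentiable_imp_continuous_on)
  next
    case (Suc k)
    then show ?case
      by (simp add: d eq Ck_bilinear[OF bounded_bilinear_matrix_vector_mult_complex] Ck_Lax assms(1))
  qed
  then show ?thesis by (simp add: smooth_def)
qed

section \<open>First-order equations for the Darboux denominator\<close>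

lemma bounded_bilinear_Darboux:
  "bounded_bilinear (\<lambda>f g. \<langle>f|J|g\<rangle> / (cnj l - l) - \<langle>f|K|g\<rangle> / (cnj l + l))"
  unfolding bilinear_conv_bounded_bilinear[symmetric] bilinear_def
  by (auto intro!: linearI simp: braket_J braket_K algebra_simps scaleR_conv_of_real[where 'a = complex] diff_divide_distrib add_divide_distrib)

text \<open>Over the common denominator \<open>(cnj l)\<^sup>2 - l\<^sup>2\<close> the diagonal
  entries of \<open>J\<close> and \<open>K\<close> combine to the weight \<open>2 * l\<close> on the
  first component and \<open>- 2 * cnj l\<close> on the other two.\<close>

lemma Darboux_form:
  assumes "cnj l - l \<noteq> 0" "cnj l + l \<noteq> 0"
  shows "\<langle>f|J|g\<rangle> / (cnj l - l) - \<langle>f|K|g\<rangle> / (cnj l + l) =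
    2 / ((cnj l)\<^sup>2 - l\<^sup>2) * (l * (cnj (f $ 1) * g $ 1) - cnj l * (cnj (f $ 2) * g $ 2 + cnj (f $ 3) * g $ 3))"
proof -
  have "(cnj l)\<^sup>2 - l\<^sup>2 = (cnj l - l) * (cnj l + l)"
    by (simp add: power2_eq_square algebra_simps)
  with assms show ?thesis
    by (simp add: braket_J braket_K divide_simps) (simp add: algebra_simps)
qed

text \<open>Inserting the Lax pair into the differentiated numerator produces the factor
  \<open>D\<close>, which cancels against the denominator. This cancellation is what keeps the
  right-hand sides regular as \<open>l\<close> becomes real.\<close>

lemma Darboux_denominator_derivs:
  assumes L: "Lax_eigenfunction u l \<Phi>" and l: "l \<noteq> 0" "cnj l - l \<noteq> 0" "cnj l + l \<noteq> 0"
  shows "Dx (\<lambda>z. Darboux_denominator l (\<Phi> z)) z =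
      4 * \<i> * l * (\<Phi> z $ 1 * cnj (\<Phi> z $ 1)) / (l * cnj l)\<^sup>2
      - 2 * \<Phi> z $ 1 * (cnj (\<Phi> z $ 2) * Dx u z $ 1 + cnj (\<Phi> z $ 3) * Dx u z $ 2) / (l * cnj l)"
    and "Dt (\<lambda>z. Darboux_denominator l (\<Phi> z)) z =
      - \<i> * l * (\<Phi> z $ 1 * cnj (\<Phi> z $ 1))
      + \<i> * cnj (\<Phi> z $ 1) * (cnj (u z $ 1) * \<Phi> z $ 2 + cnj (u z $ 2) * \<Phi> z $ 3)"
proof -
  define c where "c = cnj l"
  define D where "D = c\<^sup>2 - l\<^sup>2"
  have "D = (c - l) * (c + l)" by (simp add: D_def power2_eq_square algebra_simps)
  then have D: "D \<noteq> 0" using l by (simp add: c_def)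
  have c: "c \<noteq> 0" using l by (simp add: c_def)
  have d: "\<Phi> differentiable_on UNIV" using L by (simp add: Lax_eigenfunction_def)
  note eqs = Dx_Dt_bilinear[OF bounded_bilinear_Darboux d d, of l, folded Darboux_denominator_def,
      unfolded Darboux_form[OF l(2,3)], folded c_def, folded D_def]
  \<comment> \<open>With names for the inverses and the relations \<open>inv\<close>, the
    factorization below is a polynomial consequence that \<open>algebra\<close> can decide.\<close>
  define il ic where "il = 1 / l" and "ic = 1 / c"
  have inv: "l * il = 1" "c * ic = 1" using l c by (simp_all add: il_def ic_def)
  have cnj_il: "cnj il = ic" by (simp add: il_def ic_def c_def)
  let ?v1 = "Dx u z $ 1" and ?v2 = "Dx u z $ 2" and ?p = "\<Phi> z $ 1" and ?f = "\<Phi> z $ 2" and ?g = "\<Phi> z $ 3"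
  have x: "Dx \<Phi> z $ 1 = 2 * \<i> * il * il * ?p + (cnj ?v1 * ?f + cnj ?v2 * ?g) * il"
    "Dx \<Phi> z $ 2 = ?v1 * ?p * il" "Dx \<Phi> z $ 3 = ?v2 * ?p * il"
    unfolding Lax_eigenfunction_derivs[OF L] il_def by (simp_all add: power2_eq_square)
  have "Dx (\<lambda>z. Darboux_denominator l (\<Phi> z)) z = 2 / D *
     (l * (cnj ?p * Dx \<Phi> z $ 1) - c * (cnj ?f * Dx \<Phi> z $ 2 + cnj ?g * Dx \<Phi> z $ 3)
      + (l * (cnj (Dx \<Phi> z $ 1) * ?p) - c * (cnj (Dx \<Phi> z $ 2) * ?f + cnj (Dx \<Phi> z $ 3) * ?g)))"
    unfolding eqs by (simp add: ring_distribs add_ac)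
  also have "l * (cnj ?p * Dx \<Phi> z $ 1) - c * (cnj ?f * Dx \<Phi> z $ 2 + cnj ?g * Dx \<Phi> z $ 3)
      + (l * (cnj (Dx \<Phi> z $ 1) * ?p) - c * (cnj (Dx \<Phi> z $ 2) * ?f + cnj (Dx \<Phi> z $ 3) * ?g)) =
     D * (2 * \<i> * l * (?p * cnj ?p) * (il * ic)^2 - ?p * (cnj ?f * ?v1 + cnj ?g * ?v2) * (il * ic))"
    unfolding x complex_cnj_add complex_cnj_mult complex_cnj_cnj complex_cnj_i complex_cnj_numeral cnj_il D_def
    using inv by algebra
  also have "2 / D * (D * (2 * \<i> * l * (?p * cnj ?p) * (il * ic)^2 - ?p * (cnj ?f * ?v1 + cnj ?g * ?v2) * (il * ic)))
     = 4 * \<i> * l * (?p * cnj ?p) / (l * c)\<^sup>2 - 2 * ?p * (cnj ?f * ?v1 + cnj ?g * ?v2) / (l * c)"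
    using D by (simp add: il_def ic_def power_divide field_simps)
  finally show "Dx (\<lambda>z. Darboux_denominator l (\<Phi> z)) z =
      4 * \<i> * l * (?p * cnj ?p) / (l * cnj l)\<^sup>2 - 2 * ?p * (cnj ?f * ?v1 + cnj ?g * ?v2) / (l * cnj l)"
    by (simp only: c_def)
  have "Dt (\<lambda>z. Darboux_denominator l (\<Phi> z)) z = 1 / D *
     (2 * (l * (cnj ?p * Dt \<Phi> z $ 1) - c * (cnj ?f * Dt \<Phi> z $ 2 + cnj ?g * Dt \<Phi> z $ 3)
      + (l * (cnj (Dt \<Phi> z $ 1) * ?p) - c * (cnj (Dt \<Phi> z $ 2) * ?f + cnj (Dt \<Phi> z $ 3) * ?g))))"
    unfolding eqs by (simp add: ring_distribs add_ac)
  also have "2 * (l * (cnj ?p * Dt \<Phi> z $ 1) - c * (cnj ?f * Dt \<Phi> z $ 2 + cnj ?g * Dt \<Phi> z $ 3)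
      + (l * (cnj (Dt \<Phi> z $ 1) * ?p) - c * (cnj (Dt \<Phi> z $ 2) * ?f + cnj (Dt \<Phi> z $ 3) * ?g))) =
     D * (- \<i> * l * (?p * cnj ?p) + \<i> * cnj ?p * (cnj (u z $ 1) * ?f + cnj (u z $ 2) * ?g))"
    unfolding Lax_eigenfunction_derivs[OF L] D_def c_def
    by (simp add: field_simps power2_eq_square) 
  also have "1 / D * (D * (- \<i> * l * (?p * cnj ?p) + \<i> * cnj ?p * (cnj (u z $ 1) * ?f + cnj (u z $ 2) * ?g)))
     = - \<i> * l * (?p * cnj ?p) + \<i> * cnj ?p * (cnj (u z $ 1) * ?f + cnj (u z $ 2) * ?g)"
    using D by simp
  finally show "Dt (\<lambda>z. Darboux_denominator l (\<Phi> z)) z =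
     - \<i> * l * (?p * cnj ?p) + \<i> * cnj ?p * (cnj (u z $ 1) * ?f + cnj (u z $ 2) * ?g)" .
qed

subsection \<open>Non-vanishing of Lax eigenfunctions\<close>

text \<open>Gronwall argument: if \<open>C\<close> bounds \<open>M\<close> on the interval, the
  squared norm of \<open>f\<close> times \<open>exp (- 2 * C * s)\<close> has nonpositive
  derivative, starts at 0 and is never negative.\<close>

lemma ODE_zero_forward:
  fixes f f' :: "real \<Rightarrow> 'a::real_inner"
  assumes d: "\<And>s. (f has_vector_derivative f' s) (at s)"
    and bound: "\<And>s. norm (f' s) \<le> M s * norm (f s)" and M: "continuous_on UNIV M"
    and "f a = 0" "a \<le> b"
  shows "f b = 0"
proof -
  have "bounded (M ` {a..b})"
    by (intro compact_imp_bounded compact_continuous_image continuous_on_subset[OF M]) auto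
  then obtain C where "\<forall>x \<in> M ` {a..b}. \<bar>x\<bar> \<le> C"
    unfolding bounded_real by blast
  then have C: "M s \<le> C" if "s \<in> {a..b}" for s
    using that abs_ge_self[of "M s"] by force
  define g where "g s = (f s \<bullet> f s) * exp (- 2 * C * s)" for s
  have "g b \<le> g a"
  proof (rule DERIV_nonpos_imp_nonincreasing[OF \<open>a \<le> b\<close>])
    fix s assume s: "a \<le> s" "s \<le> b"
    have 1: "((\<lambda>s. f s \<bullet> f s) has_real_derivative 2 * (f s \<bullet> f' s)) (at s)"
      unfolding has_field_derivative_def
      using has_derivative_inner[OF d[of s, unfolded has_vector_derivative_def] d[of s, unfolded has_vector_derivative_def]]
      by (rule has_derivative_eq_rhs) (auto simp: inner_commute)
    have "f s \<bullet> f' s \<le> norm (f s) * norm (f' s)" by (rule norm_cauchy_schwarz)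
    also have "\<dots> \<le> norm (f s) * (C * norm (f s))"
      using order_trans[OF bound[of s] mult_right_mono[OF C[of s] norm_ge_zero]] s
      by (intro mult_left_mono) auto
    also have "\<dots> = C * (f s \<bullet> f s)" by (simp add: dot_square_norm power2_eq_square)
    finally have 2: "f s \<bullet> f' s \<le> C * (f s \<bullet> f s)" .
    have "(g has_real_derivative (2 * (f s \<bullet> f' s) - 2 * C * (f s \<bullet> f s)) * exp (- 2 * C * s)) (at s)"
      unfolding g_def by (rule derivative_eq_intros 1 refl)+ (simp add: algebra_simps)
    moreover have "(2 * (f s \<bullet> f' s) - 2 * C * (f s \<bullet> f s)) * exp (- 2 * C * s) \<le> 0"
      using 2 by (intro mult_nonpos_nonneg) auto
    ultimately show "\<exists>y. DERIV g s :> y \<and> y \<le> 0" by blast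
  qed
  then have "(f b \<bullet> f b) * exp (- 2 * C * b) \<le> 0" using \<open>f a = 0\<close> by (simp add: g_def)
  then have "f b \<bullet> f b \<le> 0" using exp_gt_zero[of "- 2 * C * b"] by (meson mult_pos_pos not_le)
  then show ?thesis by (meson inner_gt_zero_iff not_le)
qed

text \<open>Backward uniqueness is forward uniqueness after the reflection of \<open>s\<close> to
  \<open>- s\<close>.\<close>

lemma ODE_zero:
  fixes f f' :: "real \<Rightarrow> 'a::real_inner"
  assumes d: "\<And>s. (f has_vector_derivative f' s) (at s)"
    and bound: "\<And>s. norm (f' s) \<le> M s * norm (f s)" and M: "continuous_on UNIV M"
    and "f a = 0"
  shows "f b = 0"
proof (cases "a \<le> b")
  case True
  with assms show ?thesis by (rule ODE_zero_forward)
next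
  case False
  have 1: "((\<lambda>s. f (- s)) has_vector_derivative - f' (- s)) (at s)" for s
    using vector_diff_chain_at[of uminus "-1" s f "f' (- s)"] d[of "- s"]
      has_vector_derivative_minus[OF has_vector_derivative_id, of "at s"]
    by (simp add: o_def)
  have 2: "continuous_on UNIV (\<lambda>s. M (- s))"
    by (rule continuous_on_compose2[OF M]) (auto intro: continuous_intros)
  have "f (- (- b)) = 0"
    by (rule ODE_zero_forward[of "\<lambda>s. f (- s)", OF 1 _ 2, of "- a"]) (use assms False in auto)
  then show ?thesis by simp
qed

text \<open>Any two points are joined by a horizontal segment followed by a vertical one. On the
  first the x-equation is a linear ODE, on the second the t-equation, so a zero propagates along
  both.\<close>

lemma Lax_eigenfunction_zero:
  assumes u: "smooth u" and L: "Lax_eigenfunction u l \<Phi>" and zero: "\<Phi> z0 = 0"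
  shows "\<Phi> z = 0"
proof -
  obtain N where N: "\<And>A v. norm (A *v v :: complex^3) \<le> norm (A :: complex^3^3) * norm v * N"
    using bounded_bilinear.nonneg_bounded[OF bounded_bilinear_matrix_vector_mult_complex] by blast
  have bound: "norm (A *v v) \<le> (norm A * N) * norm v" for A :: "complex^3^3" and v :: "complex^3"
    using N[of A v] by (simp add: mult_ac)
  obtain x0 t0 x t where z: "z0 = (x0, t0)" "z = (x, t)" by (cases z0, cases z)
  have d: "\<Phi> differentiable (at z)" for z
    using L unfolding Lax_eigenfunction_def differentiable_on_def by blast
  have eq: "Dx \<Phi> z = Lax_U u l z *v \<Phi> z" "Dt \<Phi> z = Lax_V u l z *v \<Phi> z" for z
    using L unfolding Lax_eigenfunction_def by blast+
  have cont: "continuous_on UNIV (Lax_U u l)" "continuous_on UNIV (Lax_V u l)"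
    using Ck_Lax[OF u, of 0] by auto
  have "\<Phi> (x, t0) = 0"
  proof (rule ODE_zero[of "\<lambda>s. \<Phi> (s, t0)"])
    show "((\<lambda>s. \<Phi> (s, t0)) has_vector_derivative Lax_U u l (s, t0) *v \<Phi> (s, t0)) (at s)" for s
      using has_vector_derivative_Dx_Dt(1)[OF d] by (simp add: eq)
    show "continuous_on UNIV (\<lambda>s. norm (Lax_U u l (s, t0)) * N)"
      by (intro continuous_intros continuous_on_compose2[OF cont(1)]) auto
  qed (use bound zero z in auto)
  have "\<Phi> (x, t) = 0"
  proof (rule ODE_zero[of "\<lambda>s. \<Phi> (x, s)"])
    show "((\<lambda>s. \<Phi> (x, s)) has_vector_derivative Lax_V u l (x, s) *v \<Phi> (x, s)) (at s)" for s
      using has_vector_derivative_Dx_Dt(2)[OF d] by (simp add: eq)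
    show "continuous_on UNIV (\<lambda>s. norm (Lax_V u l (x, s)) * N)"
      by (intro continuous_intros continuous_on_compose2[OF cont(2)]) auto
    show "\<Phi> (x, t0) = 0" by fact
  qed (use bound in auto)
  then show ?thesis by (simp add: z)
qed

subsection \<open>Dressing with a null eigenfunction\<close>

text \<open>One component of the equation for the transformed potential, up to the computation of its
  derivatives: \<open>r\<close> stands for the inverse of the denominator, \<open>q\<close> for that of the spectral parameter,
  \<open>\<rho>\<close> for \<open>- m\<^sup>* / m\<close>, and the suffix \<open>t\<close> marks \<open>t\<close>-derivatives. Eliminating \<open>m\<^sup>*\<close> through
  \<open>\<rho> r\<^sup>* = - r\<close> makes it a polynomial identity.\<close>

lemma dressing_identity:
  fixes A V W P PC r q l a b g gc h :: complex
  assumes ql: "l * q = 1"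
  defines "n \<equiv> P * PC"
  defines "k \<equiv> h * q - 2 * \<i> * PC * q\<^sup>2"
  defines "\<rho> \<equiv> 1 + 2 * n * q * r"
  defines "Vt \<equiv> - A - \<i>/2 * a * V - \<i>/2 * b * A"
  defines "Wt \<equiv> \<i>/2 * l * P * A - \<i>/2 * g * A"
  defines "Pt \<equiv> (\<i>/2 * l\<^sup>2 + \<i>/2 * a) * P - \<i>/2 * l * g"
  defines "PCt \<equiv> - (\<i>/2 * l\<^sup>2 + \<i>/2 * a) * PC + \<i>/2 * l * gc"
  defines "ht \<equiv> - \<i>/2 * l * PC * b - gc - \<i>/2 * a * h"
  defines "rt \<equiv> - (r * r) * (- \<i> * l * n + \<i> * PC * g)"
  defines "kt \<equiv> ht * q - 2 * \<i> * PCt * q\<^sup>2"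
  defines "\<rho>t \<equiv> 2 * (Pt * PC + P * PCt) * q * r + 2 * n * q * rt"
  shows "\<rho>t * (V + 2 * W * r * k) + \<rho> * (Vt + 2 * Wt * r * k + 2 * W * rt * k + 2 * W * r * kt)
    + (A + 2 * PC * W * r)
    + \<i>/2 * (\<rho> * a - 2 * P * gc * r + 2 * PC * g * r * \<rho> - 4 * n\<^sup>2 * r\<^sup>2) * (V + 2 * W * r * k)
    + \<i>/2 * (\<rho> * (b + 2 * r * k * g) - 2 * P * r * (h + 2 * r * k * n)) * (A + 2 * PC * W * r) = 0"
proof -
  have "q \<noteq> 0" using ql by auto
  then have l: "l = 1 / q" "q \<noteq> 0" using ql by (simp_all add: eq_divide_eq)
  show ?thesis
    unfolding assms(2-) l(1) using l(2)
    by (simp add: field_simps power2_eq_square)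
qed


text \<open>The vector form \<open>u\<^sub>x\<^sub>t + u + (\<i>/2) (u\<^sup>\<dagger> u) u\<^sub>x
  + (\<i>/2) (u\<^sup>\<dagger> u\<^sub>x) u = 0\<close>: the diagonal contributions of the two
  cubic terms add up to the coefficient \<i>. It treats both components alike.\<close>

lemma coupled_Fokas_Lenells_iff:
  "coupled_Fokas_Lenells u \<longleftrightarrow> (\<forall>z. \<forall>j.
     Dt (Dx u) z $ j + u z $ j
       + \<i>/2 * (cnj (u z $ 1) * u z $ 1 + cnj (u z $ 2) * u z $ 2) * Dx u z $ j
       + \<i>/2 * (cnj (u z $ 1) * Dx u z $ 1 + cnj (u z $ 2) * Dx u z $ 2) * u z $ j = 0)"
  unfolding coupled_Fokas_Lenells_def forall_2 of_real_add of_real_mult complex_norm_square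
  by (simp add: algebra_simps)

text \<open>The algebra of the dressing is separated from the limit: \<open>m\<close> enters through
  its real part and its two first-order equations, which are the only facts about the limit
  denominator that the computation consumes besides differentiability and non-vanishing.\<close>

theorem null_Darboux_transform:
  fixes u :: "real \<times> real \<Rightarrow> complex^2" and lam0 :: real
    and \<Phi> :: "real \<times> real \<Rightarrow> complex^3" and m :: "real \<times> real \<Rightarrow> complex"
  assumes u: "smooth u" and sol: "coupled_Fokas_Lenells u" and lam0: "lam0 \<noteq> 0"
    and L: "Lax_eigenfunction u lam0 \<Phi>" and null: "\<And>z. \<langle>\<Phi> z|J|\<Phi> z\<rangle> = 0"
    and m: "m differentiable_on UNIV" "\<And>z. m z \<noteq> 0"
    and Re_m: "\<And>z. m z + cnj (m z) = - 2 * (\<Phi> z $ 1 * cnj (\<Phi> z $ 1)) / lam0"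
    and Dx_m: "\<And>z. Dx m z = 4 * \<i> * (\<Phi> z $ 1 * cnj (\<Phi> z $ 1)) / lam0 ^ 3
      - 2 * \<Phi> z $ 1 * (cnj (\<Phi> z $ 2) * Dx u z $ 1 + cnj (\<Phi> z $ 3) * Dx u z $ 2) / lam0\<^sup>2"
    and Dt_m: "\<And>z. Dt m z = - \<i> * lam0 * (\<Phi> z $ 1 * cnj (\<Phi> z $ 1))
      + \<i> * cnj (\<Phi> z $ 1) * (cnj (u z $ 1) * \<Phi> z $ 2 + cnj (u z $ 2) * \<Phi> z $ 3)"
  shows "smooth (\<lambda>z. limit_potential (u z) (\<Phi> z) (m z))" (is "smooth ?U")
    and "coupled_Fokas_Lenells (\<lambda>z. limit_potential (u z) (\<Phi> z) (m z))"
proof -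
  have \<Phi>: "smooth \<Phi>" using Lax_eigenfunction_smooth[OF u L] .
  have Ck_u: "Ck k u" "Ck k (Dx u)" "Ck k \<Phi>" for k
    using u smooth_Dx_Dt[OF u] \<Phi> by (auto simp: smooth_def)
  have m': "Dx m = (\<lambda>z. 4 * \<i> * (\<Phi> z $ 1 * cnj (\<Phi> z $ 1)) / lam0 ^ 3
      - 2 * \<Phi> z $ 1 * (cnj (\<Phi> z $ 2) * Dx u z $ 1 + cnj (\<Phi> z $ 3) * Dx u z $ 2) / lam0\<^sup>2)"
    "Dt m = (\<lambda>z. - \<i> * lam0 * (\<Phi> z $ 1 * cnj (\<Phi> z $ 1))
      + \<i> * cnj (\<Phi> z $ 1) * (cnj (u z $ 1) * \<Phi> z $ 2 + cnj (u z $ 2) * \<Phi> z $ 3))"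
    using Dx_m Dt_m by blast+
  have Ck_m: "Ck k m" for k
  proof (cases k)
    case 0
    then show ?thesis using m(1) by (simp add: differentiable_imp_continuous_on)
  next
    \<comment> \<open>Both derivatives of \<open>m\<close> are polynomials in smooth functions and
      their conjugates, so no induction hypothesis on \<open>m\<close> is required.\<close>
    case (Suc j)
    show ?thesis unfolding Suc Ck.simps m'
      by (intro conjI m(1) Ck_intros Ck_u)
  qed
  \<comment> \<open>The lower two components, indexed like the components of \<open>u\<close>, so
    that one computation serves both equations.\<close>
  define w where "w j z = (if j = (1::2) then \<Phi> z $ 2 else \<Phi> z $ 3)" for j z
  define r where "r = (\<lambda>z. inverse (m z))"
  define p where "p z = \<Phi> z $ 1" for z
  define l q :: complex where "l = lam0" and "q = 1 / lam0"
  have lq: "l * q = 1" "cnj l = l" "cnj q = q" using lam0 by (simp_all add: l_def q_def)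
  have U: "?U z $ j = u z $ j + 2 * cnj (p z) * w j z * r z" for z j
    using exhaust_2[of j] by (auto simp: limit_potential_def w_def r_def p_def divide_inverse)
  have Ck_w: "Ck k (w j)" for k j
    using exhaust_2[of j] by (auto simp: w_def[abs_def] intro!: Ck_intros Ck_u)
  have Ck_r: "Ck k r" for k unfolding r_def by (rule Ck_inverse[OF m(2) Ck_m])
  have Ck_p: "Ck k p" for k unfolding p_def by (intro Ck_intros Ck_u)
  have "Ck k ?U" for k
    by (rule Ck_vec) (unfold U, intro Ck_intros Ck_u Ck_p Ck_w Ck_r)
  then show smooth_U: "smooth ?U" by (simp add: smooth_def)

  define a where "a z = cnj (u z $ 1) * u z $ 1 + cnj (u z $ 2) * u z $ 2" for z
  define b where "b z = cnj (u z $ 1) * Dx u z $ 1 + cnj (u z $ 2) * Dx u z $ 2" for z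
  define g where "g z = cnj (u z $ 1) * w 1 z + cnj (u z $ 2) * w 2 z" for z
  define h where "h z = cnj (w 1 z) * Dx u z $ 1 + cnj (w 2 z) * Dx u z $ 2" for z
  define k where "k z = h z * q - 2 * \<i> * cnj (p z) * q\<^sup>2" for z
  define \<rho> where "\<rho> z = 1 + 2 * (p z * cnj (p z)) * q * r z" for z
  have cnj_a: "cnj (a z) = a z" for z by (simp add: a_def mult.commute)

  have d: "u differentiable_on UNIV" "Dx u differentiable_on UNIV" "\<Phi> differentiable_on UNIV"
    "r differentiable_on UNIV"
    using Ck_u[of "Suc 0"] Ck_r[of "Suc 0"] by simp_all
  have p': "Dx p z = 2 * \<i> * q\<^sup>2 * p z + cnj (h z) * q"
    "Dt p z = (\<i>/2 * l\<^sup>2 + \<i>/2 * a z) * p z - \<i>/2 * l * g z" for z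
    unfolding p_def[abs_def] Dx_Dt_nth[OF d(3)] Lax_eigenfunction_derivs[OF L] h_def g_def a_def w_def l_def q_def
    by (simp_all add: field_simps)
  have w': "Dx (w j) z = Dx u z $ j * p z * q"
    "Dt (w j) z = \<i>/2 * l * p z * u z $ j - \<i>/2 * g z * u z $ j" for z j
    using exhaust_2[of j] unfolding p_def[abs_def] w_def[abs_def] g_def a_def l_def q_def
    by (auto simp: Dx_Dt_nth[OF d(3)] Lax_eigenfunction_derivs[OF L] mult_ac)
  have r': "Dx r z = - (r z * r z) * (4 * \<i> * (p z * cnj (p z)) * q ^ 3 - 2 * p z * h z * q\<^sup>2)"
    "Dt r z = - (r z * r z) * (- \<i> * l * (p z * cnj (p z)) + \<i> * cnj (p z) * g z)" for z
    unfolding r_def Dx_Dt_inverse[OF m] Dx_m Dt_m p_def h_def g_def l_def q_def w_def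
    by (simp_all add: power_one_over power_inverse divide_inverse mult_ac)
  \<comment> \<open>The equation for \<open>u\<close> enters here; it eliminates the mixed
    derivative from \<open>Dt h\<close> and from \<open>Dt (Dx ?U)\<close>.\<close>
  have v': "Dt (Dx u) z $ j = - u z $ j - \<i>/2 * a z * Dx u z $ j - \<i>/2 * b z * u z $ j" for z j
    using sol[unfolded coupled_Fokas_Lenells_iff, rule_format, of z j] unfolding a_def b_def
    by (simp add: add_eq_0_iff algebra_simps)

  note der = has_derivative_Dx_Dt
  have dp: "p differentiable_on UNIV" and dw: "w j differentiable_on UNIV" for j
    using Ck_p[of "Suc 0"] Ck_w[of "Suc 0"] by simp_all
  have du: "(\<lambda>z. u z $ j) differentiable_on UNIV" and dv: "(\<lambda>z. Dx u z $ j) differentiable_on UNIV" for j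
    using bounded_linear_differentiable_on[OF bounded_linear_vec_nth d(1)]
      bounded_linear_differentiable_on[OF bounded_linear_vec_nth d(2)] by simp_all

  \<comment> \<open>By \<open>r'\<close>, \<open>Dx r z\<close> equals
    \<open>2 * p z * q * (r z)\<^sup>2 * k z\<close>. The terms containing \<open>w j z\<close>
    therefore collect to \<open>2 * w j z * r z * k z\<close> times the factor
    \<open>\<rho> z\<close> that also multiplies \<open>Dx u z $ j\<close>.\<close>
  have X: "Dx ?U z $ j = \<rho> z * (Dx u z $ j + 2 * w j z * r z * k z)" for z j
  proof -
    have "((\<lambda>z. u z $ j + 2 * cnj (p z) * w j z * r z) has_derivative
       (\<lambda>e. (fst e *\<^sub>R Dx u z $ j + snd e *\<^sub>R Dt u z $ j)
         + (2 * cnj (p z) * w j z * (fst e *\<^sub>R Dx r z + snd e *\<^sub>R Dt r z)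
         + (2 * cnj (p z) * (fst e *\<^sub>R Dx (w j) z + snd e *\<^sub>R Dt (w j) z)
           + 2 * cnj (fst e *\<^sub>R Dx p z + snd e *\<^sub>R Dt p z) * w j z) * r z))) (at z)"
      using der[OF du, of j z] unfolding Dx_Dt_nth[OF d(1)]
      by (auto intro!: derivative_eq_intros der[OF d(4)] der[OF dp] der[OF dw])
    from Dx_Dt_eqI(1)[OF this] have "Dx ?U z $ j = Dx u z $ j
         + (2 * cnj (p z) * w j z * Dx r z + (2 * cnj (p z) * Dx (w j) z + 2 * cnj (Dx p z) * w j z) * r z)"
      unfolding Dx_Dt_nth(1)[OF smooth_imp_differentiable_on[OF smooth_U], symmetric] U by simp
    also have "\<dots> = \<rho> z * (Dx u z $ j + 2 * w j z * r z * k z)"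
      unfolding p' w' r' \<rho>_def k_def complex_cnj_add complex_cnj_mult complex_cnj_power complex_cnj_cnj
        complex_cnj_i complex_cnj_numeral lq
      by algebra
    finally show ?thesis .
  qed

  have Ck_h: "Ck i h" for i unfolding h_def[abs_def] by (intro Ck_intros Ck_u Ck_w)
  have Ck_k: "Ck i k" for i unfolding k_def[abs_def] by (intro Ck_intros Ck_h Ck_p)
  have Ck_\<rho>: "Ck i \<rho>" for i unfolding \<rho>_def[abs_def] by (intro Ck_intros Ck_r Ck_p)
  have dh: "h differentiable_on UNIV" and dk: "k differentiable_on UNIV" and d\<rho>: "\<rho> differentiable_on UNIV"
    using Ck_h[of "Suc 0"] Ck_k[of "Suc 0"] Ck_\<rho>[of "Suc 0"] by simp_all
  have cnj_g: "cnj (g z) = u z $ 1 * cnj (w 1 z) + u z $ 2 * cnj (w 2 z)" for z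
    by (simp add: g_def)

  have ht: "Dt h z = - \<i>/2 * l * cnj (p z) * b z - cnj (g z) - \<i>/2 * a z * h z" for z
  proof -
    have "(h has_derivative
       (\<lambda>e. cnj (w 1 z) * (fst e *\<^sub>R Dx (Dx u) z $ 1 + snd e *\<^sub>R Dt (Dx u) z $ 1)
          + cnj (fst e *\<^sub>R Dx (w 1) z + snd e *\<^sub>R Dt (w 1) z) * Dx u z $ 1
         + (cnj (w 2 z) * (fst e *\<^sub>R Dx (Dx u) z $ 2 + snd e *\<^sub>R Dt (Dx u) z $ 2)
          + cnj (fst e *\<^sub>R Dx (w 2) z + snd e *\<^sub>R Dt (w 2) z) * Dx u z $ 2))) (at z)"
      using der[OF dv, of 1 z] der[OF dv, of 2 z] unfolding Dx_Dt_nth[OF d(2)] h_def[abs_def]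
      by (auto intro!: derivative_eq_intros der[OF dw])
    from Dx_Dt_eqI(2)[OF this] have "Dt h z = cnj (w 1 z) * Dt (Dx u) z $ 1 + cnj (Dt (w 1) z) * Dx u z $ 1
         + (cnj (w 2 z) * Dt (Dx u) z $ 2 + cnj (Dt (w 2) z) * Dx u z $ 2)"
      by simp
    then show ?thesis
      unfolding v' w' h_def b_def cnj_g
      by (simp add: lq cnj_g) (simp add: field_simps)
  qed
  have kt: "Dt k z = Dt h z * q - 2 * \<i> * cnj (Dt p z) * q\<^sup>2" for z
  proof -
    have "(k has_derivative (\<lambda>e. (fst e *\<^sub>R Dx h z + snd e *\<^sub>R Dt h z) * q
         - 2 * \<i> * cnj (fst e *\<^sub>R Dx p z + snd e *\<^sub>R Dt p z) * q\<^sup>2)) (at z)"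
      unfolding k_def[abs_def] by (auto intro!: derivative_eq_intros der[OF dh] der[OF dp])
    from Dx_Dt_eqI(2)[OF this] show ?thesis by simp
  qed
  have \<rho>t: "Dt \<rho> z = 2 * (Dt p z * cnj (p z) + p z * cnj (Dt p z)) * q * r z
      + 2 * (p z * cnj (p z)) * q * Dt r z" for z
  proof -
    have "(\<rho> has_derivative (\<lambda>e. 2 * (p z * cnj (p z)) * q * (fst e *\<^sub>R Dx r z + snd e *\<^sub>R Dt r z)
         + 2 * (p z * cnj (fst e *\<^sub>R Dx p z + snd e *\<^sub>R Dt p z)
              + (fst e *\<^sub>R Dx p z + snd e *\<^sub>R Dt p z) * cnj (p z)) * q * r z)) (at z)"
      unfolding \<rho>_def[abs_def] by (auto intro!: derivative_eq_intros der[OF d(4)] der[OF dp])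
    from Dx_Dt_eqI(2)[OF this] show ?thesis by (simp add: algebra_simps)
  qed
  have T: "Dt (Dx ?U) z $ j = Dt \<rho> z * (Dx u z $ j + 2 * w j z * r z * k z)
      + \<rho> z * (Dt (Dx u) z $ j + 2 * Dt (w j) z * r z * k z + 2 * w j z * Dt r z * k z + 2 * w j z * r z * Dt k z)"
    for z j
  proof -
    have "((\<lambda>z. \<rho> z * (Dx u z $ j + 2 * w j z * r z * k z)) has_derivative
       (\<lambda>e. \<rho> z * (fst e *\<^sub>R Dx (Dx u) z $ j + snd e *\<^sub>R Dt (Dx u) z $ j
          + (2 * w j z * r z * (fst e *\<^sub>R Dx k z + snd e *\<^sub>R Dt k z)
            + (2 * w j z * (fst e *\<^sub>R Dx r z + snd e *\<^sub>R Dt r z)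
              + 2 * (fst e *\<^sub>R Dx (w j) z + snd e *\<^sub>R Dt (w j) z) * r z) * k z))
         + (fst e *\<^sub>R Dx \<rho> z + snd e *\<^sub>R Dt \<rho> z) * (Dx u z $ j + 2 * w j z * r z * k z))) (at z)"
      using der[OF dv, of j z] unfolding Dx_Dt_nth[OF d(2)]
      by (auto intro!: derivative_eq_intros der[OF d\<rho>] der[OF dk] der[OF d(4)] der[OF dw])
    from Dx_Dt_eqI(2)[OF this] show ?thesis
      unfolding Dx_Dt_nth(2)[OF smooth_imp_differentiable_on[OF smooth_Dx_Dt(1)[OF smooth_U]], symmetric] X
      by (simp add: ring_distribs add_ac)
  qed
  have null': "p z * cnj (p z) = cnj (w 1 z) * w 1 z + cnj (w 2 z) * w 2 z" for z
    using null[of z] by (simp add: braket_J p_def w_def algebra_simps)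
  \<comment> \<open>The real-part condition gives \<open>\<rho> = - cnj m / m\<close>, and
    multiplication by \<open>1 / cnj m\<close> leaves \<open>- 1 / m\<close>.\<close>
  have \<rho>_cnj: "\<rho> z * cnj (r z) = - r z" for z
  proof -
    have "m z * r z = 1" "cnj (m z) * cnj (r z) = 1" using m(2) by (simp_all add: r_def)
    moreover have "m z + cnj (m z) = - 2 * (p z * cnj (p z)) * q"
      using Re_m[of z] by (simp add: p_def q_def)
    ultimately show ?thesis unfolding \<rho>_def by algebra
  qed
  show "coupled_Fokas_Lenells ?U"
    unfolding coupled_Fokas_Lenells_iff
  proof (intro allI)
    fix z and j :: 2
    define n where "n = p z * cnj (p z)"
    let ?P = "p z" and ?r = "r z" and ?rc = "cnj (r z)"
    have n: "n = cnj (w 1 z) * w 1 z + cnj (w 2 z) * w 2 z" unfolding n_def by (rule null')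
    \<comment> \<open>The factor \<open>\<rho> z\<close> is borrowed from \<open>Dx ?U\<close>. It
      turns every \<open>cnj (r z)\<close> into \<open>- r z\<close>, leaving a polynomial in
      \<open>r z\<close>; the null condition evaluates the squared norm of \<open>w\<close> as
      \<open>n\<close>.\<close>
    have UU: "\<rho> z * (cnj (?U z $ 1) * ?U z $ 1 + cnj (?U z $ 2) * ?U z $ 2) =
        \<rho> z * a z - 2 * ?P * cnj (g z) * ?r + 2 * cnj ?P * g z * ?r * \<rho> z - 4 * n\<^sup>2 * ?r\<^sup>2"
    proof -
      have "cnj (?U z $ 1) * ?U z $ 1 + cnj (?U z $ 2) * ?U z $ 2 =
         a z + 2 * ?P * cnj (g z) * ?rc + 2 * cnj ?P * g z * ?r
         + 4 * (?P * cnj ?P) * (cnj (w 1 z) * w 1 z + cnj (w 2 z) * w 2 z) * ?r * ?rc"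
        unfolding U a_def cnj_g g_def by (simp add: algebra_simps)
      also have "\<dots> = a z + 2 * ?P * cnj (g z) * ?rc + 2 * cnj ?P * g z * ?r + 4 * n\<^sup>2 * ?r * ?rc"
        by (simp add: n_def[symmetric] n[symmetric] power2_eq_square)
      finally show ?thesis using \<rho>_cnj[of z] by algebra
    qed
    have UX: "cnj (?U z $ 1) * Dx ?U z $ 1 + cnj (?U z $ 2) * Dx ?U z $ 2 =
        \<rho> z * (b z + 2 * ?r * k z * g z) - 2 * ?P * ?r * (h z + 2 * ?r * k z * n)"
    proof -
      have "cnj (?U z $ 1) * Dx ?U z $ 1 + cnj (?U z $ 2) * Dx ?U z $ 2 =
        \<rho> z * (b z + 2 * ?r * k z * g z)
         + 2 * ?P * (\<rho> z * ?rc) * (h z + 2 * ?r * k z * (cnj (w 1 z) * w 1 z + cnj (w 2 z) * w 2 z))"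
        unfolding U X b_def g_def h_def by (simp add: algebra_simps)
      then show ?thesis unfolding \<rho>_cnj n by simp
    qed
    have cp: "cnj (Dt p z) = - (\<i>/2 * l\<^sup>2 + \<i>/2 * a z) * cnj ?P + \<i>/2 * l * cnj (g z)"
      unfolding p' by (simp add: lq cnj_a algebra_simps)
    \<comment> \<open>The equation with the factor \<open>\<rho> z\<close> moved from
      \<open>Dx ?U z $ j\<close> to the squared norm of \<open>?U\<close>, so that \<open>UU\<close>
      applies and \<open>dressing_identity\<close> matches literally.\<close>
    have "Dt (Dx ?U) z $ j + ?U z $ j
       + \<i>/2 * (\<rho> z * (cnj (?U z $ 1) * ?U z $ 1 + cnj (?U z $ 2) * ?U z $ 2)) * (Dx u z $ j + 2 * w j z * ?r * k z)
       + \<i>/2 * (cnj (?U z $ 1) * Dx ?U z $ 1 + cnj (?U z $ 2) * Dx ?U z $ 2) * ?U z $ j = 0"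
      unfolding UU UX unfolding T U \<rho>t kt cp ht unfolding p' r' v' w' k_def \<rho>_def n_def
      using dressing_identity[OF lq(1), where A = "u z $ j" and V = "Dx u z $ j" and W = "w j z"
          and P = ?P and PC = "cnj ?P" and r = ?r and a = "a z" and b = "b z" and g = "g z"
          and gc = "cnj (g z)" and h = "h z"] by (simp only:)
    then show "Dt (Dx ?U) z $ j + ?U z $ j
       + \<i>/2 * (cnj (?U z $ 1) * ?U z $ 1 + cnj (?U z $ 2) * ?U z $ 2) * Dx ?U z $ j
       + \<i>/2 * (cnj (?U z $ 1) * Dx ?U z $ 1 + cnj (?U z $ 2) * Dx ?U z $ 2) * ?U z $ j = 0"
      unfolding X by (simp only: mult_ac)
  qed
qed

subsection \<open>The limit of the Darboux denominator\<close>

lemma bounded_bilinear_vector_scalar_mult: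
  "bounded_bilinear ((*s) :: complex \<Rightarrow> complex^'n::finite \<Rightarrow> complex^'n)"
  unfolding bilinear_conv_bounded_bilinear[symmetric] bilinear_def
  by (auto intro!: linearI simp: vec_eq_iff algebra_simps)

text \<open>Everything follows from \<open>l \<epsilon> - lam0 = O(\<epsilon>)\<close> and
  \<open>(cnj (l \<epsilon>) - l \<epsilon>) * (cnj (l \<epsilon>) + l \<epsilon>) = \<epsilon> * (cnj q - q)\<close>.\<close>

lemma spectral_asymptotics:
  fixes l :: "real \<Rightarrow> complex" and q :: complex and lam0 :: real
  assumes lam0: "lam0 > 0" and q: "cnj q - q \<noteq> 0"
    and l: "\<forall>\<^sub>F \<epsilon> in at 0. (l \<epsilon>)\<^sup>2 = lam0\<^sup>2 + \<epsilon> * q" and lim: "(l \<longlongrightarrow> lam0) (at 0)"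
  shows "\<forall>\<^sub>F \<epsilon> in at 0. l \<epsilon> \<noteq> 0 \<and> cnj (l \<epsilon>) - l \<epsilon> \<noteq> 0 \<and> cnj (l \<epsilon>) + l \<epsilon> \<noteq> 0"
    and "\<exists>C. \<forall>\<^sub>F \<epsilon> in at 0. cmod (1 / (cnj (l \<epsilon>) - l \<epsilon>) - 2 * lam0 / (cnj q - q) / \<epsilon>) \<le> C"
    and "\<exists>C. \<forall>\<^sub>F \<epsilon> in at 0. cmod (1 / (cnj (l \<epsilon>) + l \<epsilon>) - 1 / (2 * lam0)) \<le> C * \<bar>\<epsilon>\<bar>"
proof -
  \<comment> \<open>With the threshold \<open>lam0 / 2\<close>, both
    \<open>cnj (l \<epsilon>) + l \<epsilon>\<close> and \<open>l \<epsilon> + lam0\<close> have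
    modulus at least \<open>lam0\<close>, which makes the later divisions uniform.\<close>
  have Re_l: "\<forall>\<^sub>F \<epsilon> in at 0. Re (l \<epsilon>) > lam0 / 2"
    using tendsto_Re[OF lim] lam0 by (intro order_tendstoD) auto
  have nz: "\<forall>\<^sub>F \<epsilon> in at (0::real). \<epsilon> \<noteq> 0" by (simp add: eventually_at_filter)
  have l_lam0: "\<forall>\<^sub>F \<epsilon> in at 0. cmod (l \<epsilon> - lam0) \<le> cmod q / lam0 * \<bar>\<epsilon>\<bar>"
    using Re_l l
  proof eventually_elim
    case (elim \<epsilon>)
    have "(l \<epsilon> - lam0) * (l \<epsilon> + lam0) = \<epsilon> * q" using elim(2) by (simp add: power2_eq_square algebra_simps)
    then have "cmod (l \<epsilon> - lam0) * cmod (l \<epsilon> + lam0) = \<bar>\<epsilon>\<bar> * cmod q"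
      by (metis norm_mult norm_of_real)
    moreover have "lam0 \<le> cmod (l \<epsilon> + lam0)"
      using complex_Re_le_cmod[of "l \<epsilon> + lam0"] elim(1) lam0 by simp
    ultimately have "cmod (l \<epsilon> - lam0) * lam0 \<le> \<bar>\<epsilon>\<bar> * cmod q"
      by (metis mult_left_mono norm_ge_zero)
    then show ?case using lam0 by (simp add: field_simps)
  qed
  have sum: "cmod (cnj a + a - 2 * lam0) \<le> 2 * cmod (a - lam0)" for a
  proof -
    have "cnj a + a - 2 * lam0 = cnj (a - lam0) + (a - lam0)" by simp
    also have "cmod \<dots> \<le> 2 * cmod (a - lam0)"
      using norm_triangle_ineq[of "cnj (a - lam0)" "a - lam0"] by (simp only: complex_mod_cnj mult_2)
    finally show ?thesis .
  qed
  have diff: "\<forall>\<^sub>F \<epsilon> in at 0. (cnj (l \<epsilon>) - l \<epsilon>) * (cnj (l \<epsilon>) + l \<epsilon>) = \<epsilon> * (cnj q - q)"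
    using l
  proof eventually_elim
    case (elim \<epsilon>)
    have "(cnj (l \<epsilon>))\<^sup>2 = cnj ((l \<epsilon>)\<^sup>2)" by simp
    also have "\<dots> = lam0\<^sup>2 + \<epsilon> * cnj q" unfolding elim by simp
    finally show ?case using elim by (simp add: power2_eq_square algebra_simps)
  qed
  show nondeg: "\<forall>\<^sub>F \<epsilon> in at 0. l \<epsilon> \<noteq> 0 \<and> cnj (l \<epsilon>) - l \<epsilon> \<noteq> 0 \<and> cnj (l \<epsilon>) + l \<epsilon> \<noteq> 0"
    using Re_l diff nz
  proof eventually_elim
    case (elim \<epsilon>)
    then have "(cnj (l \<epsilon>) - l \<epsilon>) * (cnj (l \<epsilon>) + l \<epsilon>) \<noteq> 0" using q by simp
    moreover have "l \<epsilon> \<noteq> 0" using elim(1) lam0 by auto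
    ultimately show ?case by auto
  qed
  have "\<forall>\<^sub>F \<epsilon> in at 0. cmod (1 / (cnj (l \<epsilon>) - l \<epsilon>) - 2 * lam0 / (cnj q - q) / \<epsilon>)
      \<le> 2 * (cmod q / lam0) / cmod (cnj q - q)"
    using l_lam0 diff nz nondeg
  proof eventually_elim
    case (elim \<epsilon>)
    have "1 / (cnj (l \<epsilon>) - l \<epsilon>) = (cnj (l \<epsilon>) + l \<epsilon>) / (\<epsilon> * (cnj q - q))"
      using elim by (simp flip: elim(2))
    then have "1 / (cnj (l \<epsilon>) - l \<epsilon>) - 2 * lam0 / (cnj q - q) / \<epsilon> =
        (cnj (l \<epsilon>) + l \<epsilon> - 2 * lam0) / (\<epsilon> * (cnj q - q))"
      by (simp add: diff_divide_distrib mult.commute)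
    also have "cmod \<dots> \<le> 2 * (cmod q / lam0 * \<bar>\<epsilon>\<bar>) / (\<bar>\<epsilon>\<bar> * cmod (cnj q - q))"
      unfolding norm_divide norm_mult norm_of_real
      using sum[of "l \<epsilon>"] elim(1) by (intro divide_right_mono) auto
    also have "\<dots> = 2 * (cmod q / lam0) / cmod (cnj q - q)" using elim by simp
    finally show ?case .
  qed
  then show "\<exists>C. \<forall>\<^sub>F \<epsilon> in at 0. cmod (1 / (cnj (l \<epsilon>) - l \<epsilon>) - 2 * lam0 / (cnj q - q) / \<epsilon>) \<le> C" ..
  have "\<forall>\<^sub>F \<epsilon> in at 0. cmod (1 / (cnj (l \<epsilon>) + l \<epsilon>) - 1 / (2 * lam0))
      \<le> (2 * (cmod q / lam0) / (lam0 * (2 * lam0))) * \<bar>\<epsilon>\<bar>"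
    using l_lam0 nondeg Re_l
  proof eventually_elim
    case (elim \<epsilon>)
    have "1 / (cnj (l \<epsilon>) + l \<epsilon>) - 1 / (2 * lam0) =
        - ((cnj (l \<epsilon>) + l \<epsilon> - 2 * lam0) / ((cnj (l \<epsilon>) + l \<epsilon>) * (2 * lam0)))"
      using elim lam0 by (simp add: divide_simps) (simp add: algebra_simps)?
    also have "cmod \<dots> = cmod (cnj (l \<epsilon>) + l \<epsilon> - 2 * lam0) / (cmod (cnj (l \<epsilon>) + l \<epsilon>) * (2 * lam0))"
      using lam0 by (simp add: norm_divide norm_mult)
    also have "\<dots> \<le> 2 * (cmod q / lam0 * \<bar>\<epsilon>\<bar>) / (lam0 * (2 * lam0))"
    proof (intro frac_le mult_right_mono)
      show "cmod (cnj (l \<epsilon>) + l \<epsilon> - 2 * lam0) \<le> 2 * (cmod q / lam0 * \<bar>\<epsilon>\<bar>)"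
        using sum[of "l \<epsilon>"] elim(1) by simp
      show "lam0 \<le> cmod (cnj (l \<epsilon>) + l \<epsilon>)"
        using complex_Re_le_cmod[of "cnj (l \<epsilon>) + l \<epsilon>"] elim(3) lam0 by simp
    qed (use lam0 in auto)
    finally show ?case by simp
  qed
  then show "\<exists>C. \<forall>\<^sub>F \<epsilon> in at 0. cmod (1 / (cnj (l \<epsilon>) + l \<epsilon>) - 1 / (2 * lam0)) \<le> C * \<bar>\<epsilon>\<bar>" ..
qed

text \<open>The null condition removes the constant term of the \<open>J\<close> braket, which is
  then of order \<epsilon> and compensates the simple pole of \<open>1 / (cnj l - l)\<close>. An
  error of second order in \<open>y\<close> thus becomes one of first order in the
  denominator.\<close>

lemma Darboux_denominator_expansion:
  fixes y :: "real \<Rightarrow> real \<times> real \<Rightarrow> complex^3" and l :: "real \<Rightarrow> complex" and q :: complex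
    and lam0 :: real
  assumes lam0: "lam0 > 0" and q: "cnj q - q \<noteq> 0"
    and l: "\<forall>\<^sub>F \<epsilon> in at 0. (l \<epsilon>)\<^sup>2 = lam0\<^sup>2 + \<epsilon> * q" and lim: "(l \<longlongrightarrow> lam0) (at 0)"
    and y: "O_C2loc (\<lambda>\<epsilon>. \<epsilon>\<^sup>2) (\<lambda>\<epsilon> z. y \<epsilon> z - (yR z + (\<epsilon> * q) *s Y z))"
    and Ck: "Ck 2 yR" "Ck 2 Y"
    and null: "\<And>z. \<langle>yR z|J|yR z\<rangle> = 0"
  shows "O_C2loc abs (\<lambda>\<epsilon> z. Darboux_denominator (l \<epsilon>) (y \<epsilon> z) - limit_denominator lam0 q (yR z) (Y z))"
proof -
  define r where "r \<epsilon> z = y \<epsilon> z - (yR z + (\<epsilon> * q) *s Y z)" for \<epsilon> z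
  define d where "d \<epsilon> z = (\<epsilon> * q) *s Y z + r \<epsilon> z" for \<epsilon> z
  \<comment> \<open>The residue of the pole: \<open>1 / (cnj l - l)\<close> is
    \<open>(cnj l + l) / (\<epsilon> * (cnj q - q))\<close>, and \<open>cnj l + l\<close> tends to
    \<open>2 * lam0\<close>. What remains, \<open>\<alpha>\<close>, is bounded.\<close>
  define c where "c = 2 * lam0 / (cnj q - q)"
  define \<alpha> where "\<alpha> \<epsilon> = 1 / (cnj (l \<epsilon>) - l \<epsilon>) - c / \<epsilon>" for \<epsilon> :: real
  define \<beta> where "\<beta> \<epsilon> = 1 / (cnj (l \<epsilon>) + l \<epsilon>) - 1 / (2 * lam0)" for \<epsilon>
  define A where "A z = cnj q * \<langle>Y z|J|yR z\<rangle> + q * \<langle>yR z|J|Y z\<rangle>" for z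
  define eJ where "eJ \<epsilon> z = \<langle>yR z|J|r \<epsilon> z\<rangle> + \<langle>r \<epsilon> z|J|yR z\<rangle> + \<langle>d \<epsilon> z|J|d \<epsilon> z\<rangle>" for \<epsilon> z
  define eK where "eK \<epsilon> z = \<langle>yR z|K|d \<epsilon> z\<rangle> + \<langle>d \<epsilon> z|K|yR z\<rangle> + \<langle>d \<epsilon> z|K|d \<epsilon> z\<rangle>" for \<epsilon> z
  obtain C1 C2 where \<alpha>: "\<forall>\<^sub>F \<epsilon> in at 0. cmod (\<alpha> \<epsilon>) \<le> C1 * 1"
    and \<beta>: "\<forall>\<^sub>F \<epsilon> in at 0. cmod (\<beta> \<epsilon>) \<le> C2 * \<bar>\<epsilon>\<bar>"
    using spectral_asymptotics(2,3)[OF lam0 q l lim] unfolding \<alpha>_def \<beta>_def c_def by auto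
  have nz: "\<forall>\<^sub>F \<epsilon> in at (0::real). \<epsilon> \<noteq> 0" by (simp add: eventually_at_filter)
  have small: "\<forall>\<^sub>F \<epsilon> in at (0::real). \<bar>\<epsilon>\<bar> \<le> 1"
    by (auto simp: eventually_at dist_real_def intro: exI[of _ 1])
  have bil: "O_C2loc (\<lambda>\<epsilon>. h1 \<epsilon> * h2 \<epsilon>) (\<lambda>\<epsilon> z. \<langle>f1 \<epsilon> z|M|f2 \<epsilon> z\<rangle>)"
    if "O_C2loc h1 f1" "O_C2loc h2 f2" for h1 h2 f1 f2 M
    by (rule O_C2loc_bilinear[OF bounded_bilinear_braket that])
  have r: "O_C2loc (\<lambda>\<epsilon>. \<epsilon>\<^sup>2) r" using y unfolding r_def[abs_def] .
  have R: "O_C2loc (\<lambda>_. 1) (\<lambda>_. yR)" by (rule O_C2loc_const[OF Ck(1)])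
  have "O_C2loc abs (\<lambda>\<epsilon> z. complex_of_real \<epsilon> * q)"
    by (rule O_C2loc_scalar[where C = "cmod q"]) (simp add: norm_mult mult.commute)
  from O_C2loc_bilinear[OF bounded_bilinear_vector_scalar_mult this O_C2loc_const[OF Ck(2)]]
  have d: "O_C2loc abs d" unfolding d_def[abs_def] by (intro O_C2loc_add[OF _ O_C2loc_square[OF r]]) simp
  have dd: "O_C2loc (\<lambda>\<epsilon>. \<epsilon>\<^sup>2) (\<lambda>\<epsilon> z. \<langle>d \<epsilon> z|M|d \<epsilon> z\<rangle>)" for M
    using bil[OF d d] by (simp add: power2_eq_square)
  have eJ: "O_C2loc (\<lambda>\<epsilon>. \<epsilon>\<^sup>2) eJ"
    unfolding eJ_def[abs_def] using bil[OF R r, of J] bil[OF r R, of J] by (intro O_C2loc_add dd) simp_all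
  have eK: "O_C2loc abs eK"
    unfolding eK_def[abs_def] using bil[OF R d, of K] bil[OF d R, of K] by (intro O_C2loc_add[OF O_C2loc_add O_C2loc_square[OF dd]]) simp_all
  have y_eq: "y \<epsilon> z = yR z + d \<epsilon> z" for \<epsilon> z by (simp add: d_def r_def)
  \<comment> \<open>Since \<epsilon> is real, conjugating \<open>\<epsilon> * q\<close> conjugates
    only \<open>q\<close>; this is the source of the weights \<open>cnj q\<close> and
    \<open>q\<close> in \<open>A\<close>.\<close>
  have NJ: "\<langle>y \<epsilon> z|J|y \<epsilon> z\<rangle> = \<epsilon> * A z + eJ \<epsilon> z" for \<epsilon> z
    using null[of z] unfolding y_eq A_def eJ_def by (simp add: braket_J d_def algebra_simps)
  have NK: "\<langle>y \<epsilon> z|K|y \<epsilon> z\<rangle> = \<langle>yR z|K|yR z\<rangle> + eK \<epsilon> z" for \<epsilon> z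
    unfolding y_eq eK_def by (simp add: braket_K algebra_simps)
  have abs_const: "O_C2loc (\<lambda>_. 1) f" if "O_C2loc abs f" for f :: "real \<Rightarrow> real \<times> real \<Rightarrow> complex"
    by (rule O_C2loc_weaken[OF that, of 1]) (use small in simp)
  have Ck_K: "Ck 2 (\<lambda>z. \<langle>yR z|K|yR z\<rangle>)" and Ck_A: "Ck 2 A"
    unfolding A_def[abs_def] by (intro Ck_intros Ck Ck_bilinear[OF bounded_bilinear_braket])+
  have O_NJ: "O_C2loc abs (\<lambda>\<epsilon> z. \<langle>y \<epsilon> z|J|y \<epsilon> z\<rangle>)"
  proof -
    have "O_C2loc abs (\<lambda>\<epsilon> z. complex_of_real \<epsilon>)"
      by (rule O_C2loc_scalar[where C = 1]) simp
    from O_C2loc_bilinear[OF bounded_bilinear_mult this O_C2loc_const[OF Ck_A]]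
    show ?thesis unfolding NJ by (intro O_C2loc_add[OF _ O_C2loc_square[OF eJ]]) simp
  qed
  have O_NK: "O_C2loc (\<lambda>_. 1) (\<lambda>\<epsilon> z. \<langle>y \<epsilon> z|K|y \<epsilon> z\<rangle>)"
    unfolding NK by (intro O_C2loc_add O_C2loc_const Ck_K abs_const eK)
  have 1: "O_C2loc abs (\<lambda>\<epsilon> z. \<alpha> \<epsilon> * \<langle>y \<epsilon> z|J|y \<epsilon> z\<rangle>)"
    using O_C2loc_bilinear[OF bounded_bilinear_mult O_C2loc_scalar[OF \<alpha>] O_NJ] by simp
  have "O_C2loc (\<lambda>\<epsilon>. 1 / \<bar>\<epsilon>\<bar>) (\<lambda>\<epsilon> z. c / \<epsilon>)"
    by (rule O_C2loc_scalar[where C = "cmod c"]) (simp add: norm_divide)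
  from O_C2loc_bilinear[OF bounded_bilinear_mult this eJ]
  have 2: "O_C2loc abs (\<lambda>\<epsilon> z. c / \<epsilon> * eJ \<epsilon> z)"
  proof (rule O_C2loc_weaken)
    show "\<forall>\<^sub>F \<epsilon> in at (0::real). 0 \<le> 1 / \<bar>\<epsilon>\<bar> * \<epsilon>\<^sup>2 \<and> 1 / \<bar>\<epsilon>\<bar> * \<epsilon>\<^sup>2 \<le> 1 * \<bar>\<epsilon>\<bar>"
      using nz
    proof eventually_elim
      case (elim \<epsilon>)
      then have eq: "1 / \<bar>\<epsilon>\<bar> * \<epsilon>\<^sup>2 = \<bar>\<epsilon>\<bar>"
        by (cases "\<epsilon> > 0") (auto simp: power2_eq_square)
      show ?case unfolding eq by simp
    qed
  qed
  have 3: "O_C2loc abs (\<lambda>\<epsilon> z. \<beta> \<epsilon> * \<langle>y \<epsilon> z|K|y \<epsilon> z\<rangle>)"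
    using O_C2loc_bilinear[OF bounded_bilinear_mult O_C2loc_scalar[OF \<beta>] O_NK] by simp
  have 4: "O_C2loc abs (\<lambda>\<epsilon> z. complex_of_real (1 / (2 * lam0)) * eK \<epsilon> z)"
    using O_C2loc_bilinear[OF bounded_bilinear_mult O_C2loc_const[OF Ck_const[of 2 "complex_of_real (1 / (2 * lam0))"]] eK] by simp
  \<comment> \<open>The error splits into the corrections \<open>\<alpha>\<close> and
    \<open>\<beta>\<close> to the two coefficients and the remainders \<open>eJ\<close> and
    \<open>eK\<close> of the two brakets. The identity divides by \<epsilon>, so it is asserted for
    nonzero \<epsilon> only.\<close>
  show ?thesis
  proof (rule O_C2loc_cong[OF O_C2loc_add[OF O_C2loc_add[OF 1 2]
          O_C2loc_minus[OF O_C2loc_add[OF 3 4]]]], use nz in eventually_elim, rule ext)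
    fix \<epsilon> :: real and z assume \<epsilon>: "\<epsilon> \<noteq> 0"
    have J: "c / \<epsilon> * \<langle>y \<epsilon> z|J|y \<epsilon> z\<rangle> = c * A z + c / \<epsilon> * eJ \<epsilon> z"
      unfolding NJ using \<epsilon> by (simp add: field_simps)
    have K: "complex_of_real (1 / (2 * lam0)) * \<langle>y \<epsilon> z|K|y \<epsilon> z\<rangle> =
        \<langle>yR z|K|yR z\<rangle> / (2 * lam0) + complex_of_real (1 / (2 * lam0)) * eK \<epsilon> z"
      unfolding NK by (simp add: add_divide_distrib)
    show "Darboux_denominator (l \<epsilon>) (y \<epsilon> z) - limit_denominator lam0 q (yR z) (Y z) =
      \<alpha> \<epsilon> * \<langle>y \<epsilon> z|J|y \<epsilon> z\<rangle> + c / \<epsilon> * eJ \<epsilon> z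
       + - (\<beta> \<epsilon> * \<langle>y \<epsilon> z|K|y \<epsilon> z\<rangle> + complex_of_real (1 / (2 * lam0)) * eK \<epsilon> z)"
      unfolding Darboux_denominator_def limit_denominator_def \<alpha>_def \<beta>_def left_diff_distrib J
        A_def[symmetric]
      using K by (simp add: c_def algebra_simps)
  qed
qed

text \<open>The bracket \<open>A\<close> equals its conjugate while its coefficient \<open>c\<close>
  is purely imaginary, so only the \<open>K\<close> term contributes to the real part. For a null
  vector that term is twice the squared modulus of the first component.\<close>

lemma Re_limit_denominator:
  fixes lam0 :: real
  assumes q: "cnj q - q \<noteq> 0" and null: "\<langle>yR|J|yR\<rangle> = 0"
  shows "limit_denominator lam0 q yR Y + cnj (limit_denominator lam0 q yR Y)
      = - 2 * (yR $ 1 * cnj (yR $ 1)) / lam0"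
    and "Re (limit_denominator lam0 q yR Y) = - (norm yR)\<^sup>2 / (2 * lam0)"
proof -
  define A where "A = cnj q * \<langle>Y|J|yR\<rangle> + q * \<langle>yR|J|Y\<rangle>"
  have "\<langle>Y|J|yR\<rangle> = cnj \<langle>yR|J|Y\<rangle>" by (simp add: braket_J mult.commute)
  then have A: "cnj A = A" by (simp add: A_def add.commute)
  define c where "c = 2 * lam0 / (cnj q - q)"
  have "cnj c = 2 * lam0 / (- (cnj q - q))" by (simp add: c_def)
  also have "\<dots> = - c" by (simp only: c_def divide_minus_right)
  finally have c: "cnj c = - c" .
  have norm: "\<langle>yR|K|yR\<rangle> = complex_of_real ((norm yR)\<^sup>2)"
    unfolding braket_K power2_norm_eq_inner inner_vec_def sum_3
    by (simp only: of_real_add complex_norm_square mult.commute flip: power2_norm_eq_inner)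
  have "limit_denominator lam0 q yR Y = c * A - complex_of_real ((norm yR)\<^sup>2) / (2 * lam0)"
    by (simp add: limit_denominator_def c_def A_def norm)
  then have sum: "limit_denominator lam0 q yR Y + cnj (limit_denominator lam0 q yR Y) =
      - complex_of_real ((norm yR)\<^sup>2) / lam0"
    by (simp add: A c)
  have "\<langle>yR|K|yR\<rangle> = 2 * (yR $ 1 * cnj (yR $ 1))"
    using null by (simp add: braket_J braket_K algebra_simps)
  with sum norm show "limit_denominator lam0 q yR Y + cnj (limit_denominator lam0 q yR Y)
      = - 2 * (yR $ 1 * cnj (yR $ 1)) / lam0" by simp
  have "2 * Re (limit_denominator lam0 q yR Y) = - (norm yR)\<^sup>2 / lam0"
    using arg_cong[OF sum, of Re] by (simp add: Re_divide_of_real)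
  then show "Re (limit_denominator lam0 q yR Y) = - (norm yR)\<^sup>2 / (2 * lam0)" by simp
qed

text \<open>The derivatives of the denominators at \<open>l \<epsilon>\<close> have two limits: the
  derivatives of \<open>m\<close>, by the C^2 remainder, and the regular right-hand sides at
  \<open>lam0\<close>, by continuity. Uniqueness of limits identifies them.\<close>

lemma limit_denominator_derivs:
  fixes y :: "real \<Rightarrow> real \<times> real \<Rightarrow> complex^3" and l :: "real \<Rightarrow> complex" and q :: complex
    and lam0 :: real
  assumes u: "smooth u" and lam0: "lam0 > 0" and q: "cnj q - q \<noteq> 0"
    and l: "\<forall>\<^sub>F \<epsilon> in at 0. (l \<epsilon>)\<^sup>2 = lam0\<^sup>2 + \<epsilon> * q" and lim: "(l \<longlongrightarrow> lam0) (at 0)"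
    and L: "\<forall>\<^sub>F \<epsilon> in at 0. Lax_eigenfunction u (l \<epsilon>) (y \<epsilon>)"
    and y: "\<And>z. ((\<lambda>\<epsilon>. y \<epsilon> z) \<longlongrightarrow> yR z) (at 0)"
    and m: "m differentiable_on UNIV"
    and O_m: "O_C2loc abs (\<lambda>\<epsilon> z. Darboux_denominator (l \<epsilon>) (y \<epsilon> z) - m z)"
  shows "Dx m z = 4 * \<i> * (yR z $ 1 * cnj (yR z $ 1)) / lam0 ^ 3
      - 2 * yR z $ 1 * (cnj (yR z $ 2) * Dx u z $ 1 + cnj (yR z $ 3) * Dx u z $ 2) / lam0\<^sup>2"
    and "Dt m z = - \<i> * lam0 * (yR z $ 1 * cnj (yR z $ 1))
      + \<i> * cnj (yR z $ 1) * (cnj (u z $ 1) * yR z $ 2 + cnj (u z $ 2) * yR z $ 3)"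
proof -
  define M where "M \<epsilon> = (\<lambda>z. Darboux_denominator (l \<epsilon>) (y \<epsilon> z))" for \<epsilon>
  note nondeg = spectral_asymptotics(1)[OF lam0 q l lim]
  have minus_m: "(\<lambda>z. - m z) differentiable_on UNIV"
    by (rule bounded_linear_differentiable_on[OF bounded_linear_minus[OF bounded_linear_ident] m])
  have eqs: "\<forall>\<^sub>F \<epsilon> in at 0. Dx (\<lambda>z. M \<epsilon> z - m z) z = Dx (M \<epsilon>) z - Dx m z
      \<and> Dt (\<lambda>z. M \<epsilon> z - m z) z = Dt (M \<epsilon>) z - Dt m z"
    using L
  proof eventually_elim
    case (elim \<epsilon>)
    have "y \<epsilon> differentiable_on UNIV" using elim by (simp add: Lax_eigenfunction_def)
    then have "M \<epsilon> differentiable_on UNIV"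
      unfolding M_def Darboux_denominator_def
      by (intro bounded_bilinear_differentiable_on[OF bounded_bilinear_Darboux])
    from Dx_Dt_add[OF this minus_m] Dx_Dt_linear[OF bounded_linear_minus[OF bounded_linear_ident] m]
    show ?case by simp
  qed
  have "((\<lambda>\<epsilon>. Dx (M \<epsilon>) z - Dx m z) \<longlongrightarrow> 0) (at 0)"
    by (rule Lim_transform_eventually[OF O_C2loc_tendsto(2)[OF O_m, of z]])
      (use eqs in eventually_elim, simp add: M_def)
  then have x1: "((\<lambda>\<epsilon>. Dx (M \<epsilon>) z) \<longlongrightarrow> Dx m z) (at 0)" by (rule LIM_zero_cancel)
  have "((\<lambda>\<epsilon>. Dt (M \<epsilon>) z - Dt m z) \<longlongrightarrow> 0) (at 0)"
    by (rule Lim_transform_eventually[OF O_C2loc_tendsto(3)[OF O_m, of z]])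
      (use eqs in eventually_elim, simp add: M_def)
  then have t1: "((\<lambda>\<epsilon>. Dt (M \<epsilon>) z) \<longlongrightarrow> Dt m z) (at 0)" by (rule LIM_zero_cancel)
  note lims = tendsto_vec_nth[OF y] lim
  have "((\<lambda>\<epsilon>. 4 * \<i> * l \<epsilon> * (y \<epsilon> z $ 1 * cnj (y \<epsilon> z $ 1)) / (l \<epsilon> * cnj (l \<epsilon>))\<^sup>2
      - 2 * y \<epsilon> z $ 1 * (cnj (y \<epsilon> z $ 2) * Dx u z $ 1 + cnj (y \<epsilon> z $ 3) * Dx u z $ 2) / (l \<epsilon> * cnj (l \<epsilon>)))
     \<longlongrightarrow> 4 * \<i> * lam0 * (yR z $ 1 * cnj (yR z $ 1)) / (lam0 * cnj lam0)\<^sup>2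
      - 2 * yR z $ 1 * (cnj (yR z $ 2) * Dx u z $ 1 + cnj (yR z $ 3) * Dx u z $ 2) / (lam0 * cnj lam0)) (at 0)"
    using lam0 by (intro tendsto_intros lims) auto
  moreover have "\<forall>\<^sub>F \<epsilon> in at 0. 4 * \<i> * l \<epsilon> * (y \<epsilon> z $ 1 * cnj (y \<epsilon> z $ 1)) / (l \<epsilon> * cnj (l \<epsilon>))\<^sup>2
      - 2 * y \<epsilon> z $ 1 * (cnj (y \<epsilon> z $ 2) * Dx u z $ 1 + cnj (y \<epsilon> z $ 3) * Dx u z $ 2) / (l \<epsilon> * cnj (l \<epsilon>))
      = Dx (M \<epsilon>) z"
    using L nondeg by eventually_elim (unfold M_def, rule Darboux_denominator_derivs(1)[symmetric], auto)
  ultimately have x2: "((\<lambda>\<epsilon>. Dx (M \<epsilon>) z) \<longlongrightarrow> 4 * \<i> * lam0 * (yR z $ 1 * cnj (yR z $ 1)) / (lam0 * cnj lam0)\<^sup>2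
      - 2 * yR z $ 1 * (cnj (yR z $ 2) * Dx u z $ 1 + cnj (yR z $ 3) * Dx u z $ 2) / (lam0 * cnj lam0)) (at 0)"
    by (rule Lim_transform_eventually)
  have "((\<lambda>\<epsilon>. - \<i> * l \<epsilon> * (y \<epsilon> z $ 1 * cnj (y \<epsilon> z $ 1))
      + \<i> * cnj (y \<epsilon> z $ 1) * (cnj (u z $ 1) * y \<epsilon> z $ 2 + cnj (u z $ 2) * y \<epsilon> z $ 3))
     \<longlongrightarrow> - \<i> * lam0 * (yR z $ 1 * cnj (yR z $ 1))
      + \<i> * cnj (yR z $ 1) * (cnj (u z $ 1) * yR z $ 2 + cnj (u z $ 2) * yR z $ 3)) (at 0)"
    by (intro tendsto_intros lims)
  moreover have "\<forall>\<^sub>F \<epsilon> in at 0. - \<i> * l \<epsilon> * (y \<epsilon> z $ 1 * cnj (y \<epsilon> z $ 1))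
      + \<i> * cnj (y \<epsilon> z $ 1) * (cnj (u z $ 1) * y \<epsilon> z $ 2 + cnj (u z $ 2) * y \<epsilon> z $ 3)
      = Dt (M \<epsilon>) z"
    using L nondeg by eventually_elim (unfold M_def, rule Darboux_denominator_derivs(2)[symmetric], auto)
  ultimately have t2: "((\<lambda>\<epsilon>. Dt (M \<epsilon>) z) \<longlongrightarrow> - \<i> * lam0 * (yR z $ 1 * cnj (yR z $ 1))
      + \<i> * cnj (yR z $ 1) * (cnj (u z $ 1) * yR z $ 2 + cnj (u z $ 2) * yR z $ 3)) (at 0)"
    by (rule Lim_transform_eventually)
  show "Dx m z = 4 * \<i> * (yR z $ 1 * cnj (yR z $ 1)) / lam0 ^ 3
      - 2 * yR z $ 1 * (cnj (yR z $ 2) * Dx u z $ 1 + cnj (yR z $ 3) * Dx u z $ 2) / lam0\<^sup>2"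
    using LIM_unique[OF x1 x2] lam0 by (simp add: power2_eq_square power3_eq_cube mult_ac)
  show "Dt m z = - \<i> * lam0 * (yR z $ 1 * cnj (yR z $ 1))
      + \<i> * cnj (yR z $ 1) * (cnj (u z $ 1) * yR z $ 2 + cnj (u z $ 2) * yR z $ 3)"
    by (rule LIM_unique[OF t1 t2])
qed

section \<open>Assembly for a fixed direction \<open>q\<close>\<close>

theorem theorem7:
  fixes u :: "real \<times> real \<Rightarrow> complex^2"
    and lam0 :: real
    and lam :: "complex \<Rightarrow> complex"
    and S :: "complex set"
    and Q :: "complex set"
    and y :: "complex \<Rightarrow> real \<times> real \<Rightarrow> complex^3"
    and yR y\<mu> :: "real \<times> real \<Rightarrow> complex^3"
  defines "\<mm> \<equiv> (\<lambda>q z. limit_denominator lam0 q (yR z) (y\<mu> z))"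
  defines "uR \<equiv> (\<lambda>q z. limit_potential (u z) (yR z) (\<mm> q z))"
  assumes u_smooth: "smooth u"
    and u_solution: "coupled_Fokas_Lenells u"
    and "lam0 > 0"
    and branch: "open S" "0 \<in> S" "lam holomorphic_on S"
      "\<And>\<eta> :: complex. \<eta> \<in> S \<Longrightarrow> (lam \<eta>)\<^sup>2 = lam0\<^sup>2 + \<eta>" "lam 0 = lam0"
    and Q: "Q \<subseteq> - \<real>"
    and y_Lax: "\<And>q :: complex. q \<in> Q \<Longrightarrow> \<forall>\<^sub>F \<epsilon> :: real in at 0. Lax_eigenfunction u (lam (\<epsilon> * q)) (y (\<epsilon> * q))"
    and y_expansion: "\<And>q :: complex. q \<in> Q \<Longrightarrow>
      O_C2loc (\<lambda>\<epsilon>. (cmod (\<epsilon> * q))\<^sup>2) (\<lambda>\<epsilon> z. y (\<epsilon> * q) z - (yR z + (\<epsilon> * q) *s y\<mu> z))"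
    and yR_Lax: "Lax_eigenfunction u lam0 yR"
    and yR_nontrivial: "\<exists>z. yR z \<noteq> 0"
    and yR_null: "\<And>z. \<langle>yR z|J|yR z\<rangle> = 0"
  shows "\<forall>q\<in>Q.
      O_C2loc (\<lambda>\<epsilon>. \<bar>\<epsilon>\<bar>) (\<lambda>\<epsilon> z. Darboux_denominator (lam (\<epsilon> * q)) (y (\<epsilon> * q) z) - \<mm> q z) \<and>
      (\<forall>z. Re (\<mm> q z) = - (norm (yR z))\<^sup>2 / (2 * lam0) \<and> Re (\<mm> q z) < 0) \<and>
      smooth (uR q) \<and>
      coupled_Fokas_Lenells (uR q)"
proof
  fix q assume "q \<in> Q"
  then have q: "cnj q - q \<noteq> 0" using Q Reals_cnj_iff[of q] by auto
  then have "q \<noteq> 0" by auto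
  define r where "r \<epsilon> z = y (\<epsilon> * q) z - (yR z + (\<epsilon> * q) *s y\<mu> z)" for \<epsilon> :: real and z
  have r: "O_C2loc (\<lambda>\<epsilon>. \<epsilon>\<^sup>2) r"
    unfolding r_def[abs_def]
    by (rule O_C2loc_weaken[OF y_expansion[OF \<open>q \<in> Q\<close>], of "(cmod q)\<^sup>2"])
      (simp add: norm_mult power_mult_distrib mult.commute)
  have \<eta>: "((\<lambda>\<epsilon>. complex_of_real \<epsilon> * q) \<longlongrightarrow> 0) (at 0)"
    by (auto intro!: tendsto_eq_intros)
  have l: "\<forall>\<^sub>F \<epsilon> in at 0. (lam (complex_of_real \<epsilon> * q))\<^sup>2 = lam0\<^sup>2 + \<epsilon> * q"
    \<comment> \<open>For small \<epsilon> the point \<open>\<epsilon> * q\<close> lies in the open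
      neighbourhood \<open>S\<close> of 0, where the branch relation holds.\<close>
    using topological_tendstoD[OF \<eta> branch(1,2)] by eventually_elim (rule branch(4))
  have "isCont lam 0"
    using holomorphic_on_imp_continuous_on[OF branch(3)] branch(1,2)
    by (simp add: continuous_on_eq_continuous_at)
  from isCont_tendsto_compose[OF this \<eta>]
  have lim: "((\<lambda>\<epsilon>. lam (complex_of_real \<epsilon> * q)) \<longlongrightarrow> lam0) (at 0)" by (simp add: branch(5))
  have Ck_yR: "Ck k yR" for k
    using Lax_eigenfunction_smooth[OF u_smooth yR_Lax] by (simp add: smooth_def)
  \<comment> \<open>The regularity of \<open>y\<mu>\<close> is read off from the expansion at a
    single nonzero \<epsilon>: both \<open>y (\<epsilon> * q)\<close> and \<open>yR\<close> are
    smooth as Lax eigenfunctions, the remainder is C^2, and the expansion can be solved for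
    \<open>y\<mu>\<close>.\<close>
  have "\<forall>\<^sub>F \<epsilon> in at (0::real). \<epsilon> \<noteq> 0" by (simp add: eventually_at_filter)
  moreover have "\<forall>\<^sub>F \<epsilon> in at 0. Ck 2 (r \<epsilon>)" using r by (simp add: O_C2loc_def)
  ultimately have "\<forall>\<^sub>F \<epsilon> in at 0. \<epsilon> \<noteq> 0 \<and> Ck 2 (r \<epsilon>) \<and> Lax_eigenfunction u (lam (\<epsilon> * q)) (y (\<epsilon> * q))"
    using y_Lax[OF \<open>q \<in> Q\<close>] by eventually_elim simp
  from eventually_happens'[OF _ this] obtain \<epsilon> :: real
    where \<epsilon>: "\<epsilon> \<noteq> 0" "Ck 2 (r \<epsilon>)" "Lax_eigenfunction u (lam (\<epsilon> * q)) (y (\<epsilon> * q))"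
    by auto
  have "Ck 2 (y (\<epsilon> * q))"
    using Lax_eigenfunction_smooth[OF u_smooth \<epsilon>(3)] by (simp add: smooth_def)
  with \<epsilon>(2) have "Ck 2 (\<lambda>z. (1 / (\<epsilon> * q)) *s (y (\<epsilon> * q) z - yR z - r \<epsilon> z))"
    by (intro Ck_bilinear[OF bounded_bilinear_vector_scalar_mult] Ck_intros Ck_yR)
  also have "(\<lambda>z. (1 / (\<epsilon> * q)) *s (y (\<epsilon> * q) z - yR z - r \<epsilon> z)) = y\<mu>"
    using \<epsilon>(1) \<open>q \<noteq> 0\<close> by (simp add: r_def fun_eq_iff vec_eq_iff)
  finally have Ck_y\<mu>: "Ck 2 y\<mu>" .
  have O_m: "O_C2loc abs (\<lambda>\<epsilon> z. Darboux_denominator (lam (\<epsilon> * q)) (y (\<epsilon> * q) z) - \<mm> q z)"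
    unfolding \<mm>_def
    by (rule Darboux_denominator_expansion[OF \<open>lam0 > 0\<close> q l lim _ Ck_yR Ck_y\<mu> yR_null])
      (use r in \<open>simp add: r_def[abs_def]\<close>)
  \<comment> \<open>Nontriviality at one point spreads to all points by uniqueness for the Lax pair;
    this makes the real part strictly negative everywhere.\<close>
  have yR_nonzero: "yR z \<noteq> 0" for z
    using Lax_eigenfunction_zero[OF u_smooth yR_Lax, of z] yR_nontrivial by blast
  have Re_m: "Re (\<mm> q z) = - (norm (yR z))\<^sup>2 / (2 * lam0)" for z
    unfolding \<mm>_def by (rule Re_limit_denominator(2)[OF q yR_null])
  have Re_neg: "Re (\<mm> q z) < 0" for z
    using yR_nonzero[of z] \<open>lam0 > 0\<close> by (simp add: Re_m divide_neg_pos)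
  have y_lim: "((\<lambda>\<epsilon>. y (complex_of_real \<epsilon> * q) z) \<longlongrightarrow> yR z) (at 0)" for z
  proof (rule vec_tendstoI)
    fix i
    have "((\<lambda>\<epsilon>. r \<epsilon> z $ i) \<longlongrightarrow> 0) (at 0)"
      using tendsto_vec_nth[OF O_C2loc_tendsto(1)[OF O_C2loc_square[OF r]], of z i] by simp
    then have "((\<lambda>\<epsilon>. r \<epsilon> z $ i + yR z $ i + (\<epsilon> * q) * y\<mu> z $ i) \<longlongrightarrow> 0 + yR z $ i + 0 * y\<mu> z $ i) (at 0)"
      by (intro tendsto_intros \<eta>)
    then show "((\<lambda>\<epsilon>. y (complex_of_real \<epsilon> * q) z $ i) \<longlongrightarrow> yR z $ i) (at 0)"
      by (simp add: r_def)
  qed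
  have "Ck 2 (\<mm> q)"
    unfolding \<mm>_def limit_denominator_def
    by (intro Ck_intros Ck_bilinear[OF bounded_bilinear_braket] Ck_yR Ck_y\<mu>)
  then have m: "\<mm> q differentiable_on UNIV" by (rule Ck_2D)
  note derivs = limit_denominator_derivs[OF u_smooth \<open>lam0 > 0\<close> q l lim y_Lax[OF \<open>q \<in> Q\<close>] y_lim m O_m]
  have m_nonzero: "\<mm> q z \<noteq> 0" for z using Re_neg[of z] by auto
  have sum_m: "\<mm> q z + cnj (\<mm> q z) = - 2 * (yR z $ 1 * cnj (yR z $ 1)) / lam0" for z
    unfolding \<mm>_def by (rule Re_limit_denominator(1)[OF q yR_null])
  have "lam0 \<noteq> 0" using \<open>lam0 > 0\<close> by simp
  note dressed = null_Darboux_transform[OF u_smooth u_solution this yR_Lax yR_null m m_nonzero sum_m derivs]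
  show "O_C2loc (\<lambda>\<epsilon>. \<bar>\<epsilon>\<bar>) (\<lambda>\<epsilon> z. Darboux_denominator (lam (\<epsilon> * q)) (y (\<epsilon> * q) z) - \<mm> q z) \<and>
      (\<forall>z. Re (\<mm> q z) = - (norm (yR z))\<^sup>2 / (2 * lam0) \<and> Re (\<mm> q z) < 0) \<and>
      smooth (uR q) \<and>
      coupled_Fokas_Lenells (uR q)"
    using O_m Re_m Re_neg dressed unfolding uR_def by simp
qed

end
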